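(* Let $(M,h,\nabla)$ be a quasi-statistical manifold with $h$ symmetric or skew-symmetric. On $TM\oplus T^*M$ let $\check h(X+\alpha,Y+\beta)=h(X,Y)+h(h^{-1}(\alpha),h^{-1}(\beta))$ and $\hat\nabla_{X+\alpha}(Y+\beta)=\nabla_XY+h(\nabla_X(h^{-1}(\beta)))$. Then the generalized dual quasi-statistical connection $\hat\nabla^*_{\check h}$, defined by $$\check h(Y+\beta,(\hat\nabla^*_{\check h})_{X+\alpha}(Z+\gamma))=X(\check h(Y+\beta,Z+\gamma))-\check h(\hat\nabla_{X+\alpha}(Y+\beta),Z+\gamma)$$ for all vector fields $X,Y,Z$ and 1-forms $\alpha,\beta,\gamma$ on $M$, is given by $$(\hat\nabla^*_{\check h})_{X+\alpha}(Z+\gamma)=h^{-1}(\nabla_X(h(Z)))+\nabla_X\gamma .$$ Therefore $\hat\nabla^*_{\check h}=\hat\nabla^*$, where $\hat\nabla^*$ is the dual connection of $\hat\nabla$ with respect to $\hat h$.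
   Context: $\nabla$ is an affine connection on the smooth manifold $M$, possibly with torsion $T^\nabla(X,Y)=\nabla_XY-\nabla_YX-[X,Y]$, acting on 1-forms by $(\nabla_X\beta)(Y)=X(\beta(Y))-\beta(\nabla_XY)$. $h$ is a non-degenerate $(0,2)$-tensor field; $h$ also denotes the isomorphism $TM\to T^*M$, $h(X)=h(X,\cdot)$, with inverse $h^{-1}$. $(M,h,\nabla)$ is a quasi-statistical manifold if $(\nabla_Xh)(Y,Z)-(\nabla_Yh)(X,Z)+h(T^\nabla(X,Y),Z)=0$ for all $X,Y,Z$. On $TM\oplus T^*M$: $\hat h(X+\alpha,Y+\beta)=-\frac12(\alpha(Y)+\beta(X))$ if $h$ is symmetric, $\hat h(X+\alpha,Y+\beta)=-\frac12(\alpha(Y)-\beta(X))$ if $h$ is skew-symmetric; and $\hat\nabla^*$ is defined by $\hat h(\tau,\hat\nabla^*_{X+\alpha}\nu)=X(\hat h(\tau,\nu))-\hat h(\hat\nabla_{X+\alpha}\tau,\nu)$ for all $\tau,\nu\in C^\infty(TM\oplus T^*M)$. *)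

theory Defs
  imports "HOL-Analysis.Analysis"
begin

section \<open>Smooth manifolds\<close>

text \<open>Used for open \<open>S\<close> only; there, differentiability within \<open>S\<close> is differentiability at each point.\<close>

primrec Ck_on :: "nat \<Rightarrow> 'e::euclidean_space set \<Rightarrow> ('e \<Rightarrow> 'f::real_normed_vector) \<Rightarrow> bool" where
  "Ck_on 0 S f = continuous_on S f"
| "Ck_on (Suc k) S f =
     (f differentiable_on S \<and> (\<forall>v. Ck_on k S (\<lambda>x. frechet_derivative f (at x) v)))"

definition smooth_on :: "'e::euclidean_space set \<Rightarrow> ('e \<Rightarrow> 'f::real_normed_vector) \<Rightarrow> bool" where
  "smooth_on S f \<longleftrightarrow> (\<forall>k. Ck_on k S f)"

text \<open>The manifold is the type \<open>'a\<close>, with its topology, together with an atlas (not necessarily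
  maximal) of charts \<open>(U, \<phi>)\<close>; the values of \<open>\<phi>\<close> outside \<open>U\<close> are irrelevant.\<close>

type_synonym ('a, 'n) atlas = "('a set \<times> ('a \<Rightarrow> real ^ 'n)) set"

definition smooth_manifold ::
  "('a::{t2_space, second_countable_topology}, 'n::finite) atlas \<Rightarrow> bool" where
  "smooth_manifold A \<longleftrightarrow>
     (\<forall>(U, \<phi>) \<in> A. open U \<and> open (\<phi> ` U) \<and> homeomorphism U (\<phi> ` U) \<phi> (inv_into U \<phi>)) \<and>
     (\<Union>(U, \<phi>) \<in> A. U) = UNIV \<and>
     (\<forall>(U, \<phi>) \<in> A. \<forall>(V, \<psi>) \<in> A. smooth_on (\<phi> ` (U \<inter> V)) (\<psi> \<circ> inv_into U \<phi>))"

definition smooth_functions :: "('a, 'n::finite) atlas \<Rightarrow> ('a \<Rightarrow> real) set" where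
  "smooth_functions A = {f. \<forall>(U, \<phi>) \<in> A. smooth_on (\<phi> ` U) (f \<circ> inv_into U \<phi>)}"


section \<open>Vector fields, 1-forms and (0,2)-tensor fields\<close>

text \<open>Tangent vectors at \<open>p\<close> are derivations at \<open>p\<close> of the algebra of smooth functions. They are
  extended by \<open>0\<close> to non-smooth functions, and covectors by \<open>0\<close> outside the tangent space, so that
  equality in HOL is equality of tangent vectors and of covectors.\<close>

type_synonym 'a tvec = "('a \<Rightarrow> real) \<Rightarrow> real"
type_synonym 'a covec = "'a tvec \<Rightarrow> real"
type_synonym 'a vfield = "'a \<Rightarrow> 'a tvec"
type_synonym 'a form1 = "'a \<Rightarrow> 'a covec"
type_synonym 'a tensor2 = "'a \<Rightarrow> 'a tvec \<Rightarrow> 'a tvec \<Rightarrow> real"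

definition tangent_space :: "('a, 'n::finite) atlas \<Rightarrow> 'a \<Rightarrow> 'a tvec set" where
  "tangent_space A p =
     {v. (\<forall>f \<in> smooth_functions A. \<forall>g \<in> smooth_functions A.
            v (\<lambda>x. f x + g x) = v f + v g \<and>
            v (\<lambda>x. f x * g x) = f p * v g + g p * v f) \<and>
         (\<forall>f \<in> smooth_functions A. \<forall>c. v (\<lambda>x. c * f x) = c * v f) \<and>
         (\<forall>f. f \<notin> smooth_functions A \<longrightarrow> v f = 0)}"

definition cotangent_space :: "('a, 'n::finite) atlas \<Rightarrow> 'a \<Rightarrow> 'a covec set" where
  "cotangent_space A p =
     {a. (\<forall>v \<in> tangent_space A p. \<forall>w \<in> tangent_space A p. a (\<lambda>f. v f + w f) = a v + a w) \<and>
         (\<forall>v \<in> tangent_space A p. \<forall>c. a (\<lambda>f. c * v f) = c * a v) \<and>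
         (\<forall>v. v \<notin> tangent_space A p \<longrightarrow> a v = 0)}"

definition vector_fields :: "('a, 'n::finite) atlas \<Rightarrow> 'a vfield set" where
  "vector_fields A =
     {X. (\<forall>p. X p \<in> tangent_space A p) \<and>
         (\<forall>f \<in> smooth_functions A. (\<lambda>p. X p f) \<in> smooth_functions A)}"

definition one_forms :: "('a, 'n::finite) atlas \<Rightarrow> 'a form1 set" where
  "one_forms A =
     {\<alpha>. (\<forall>p. \<alpha> p \<in> cotangent_space A p) \<and>
         (\<forall>X \<in> vector_fields A. (\<lambda>p. \<alpha> p (X p)) \<in> smooth_functions A)}"

definition tensor_fields2 :: "('a, 'n::finite) atlas \<Rightarrow> 'a tensor2 set" where
  "tensor_fields2 A =
     {h. (\<forall>p. \<forall>u \<in> tangent_space A p. \<forall>v \<in> tangent_space A p. \<forall>w \<in> tangent_space A p. \<forall>c.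
            h p (\<lambda>f. u f + v f) w = h p u w + h p v w \<and>
            h p (\<lambda>f. c * u f) w = c * h p u w \<and>
            h p w (\<lambda>f. u f + v f) = h p w u + h p w v \<and>
            h p w (\<lambda>f. c * u f) = c * h p w u) \<and>
         (\<forall>X \<in> vector_fields A. \<forall>Y \<in> vector_fields A.
            (\<lambda>p. h p (X p) (Y p)) \<in> smooth_functions A)}"

definition nondegenerate :: "('a, 'n::finite) atlas \<Rightarrow> 'a tensor2 \<Rightarrow> bool" where
  "nondegenerate A h \<longleftrightarrow>
     (\<forall>p. \<forall>v \<in> tangent_space A p. (\<forall>w \<in> tangent_space A p. h p v w = 0) \<longrightarrow> v = (\<lambda>f. 0))"

definition symmetric_tensor :: "('a, 'n::finite) atlas \<Rightarrow> 'a tensor2 \<Rightarrow> bool" where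
  "symmetric_tensor A h \<longleftrightarrow>
     (\<forall>p. \<forall>v \<in> tangent_space A p. \<forall>w \<in> tangent_space A p. h p v w = h p w v)"

definition skew_tensor :: "('a, 'n::finite) atlas \<Rightarrow> 'a tensor2 \<Rightarrow> bool" where
  "skew_tensor A h \<longleftrightarrow>
     (\<forall>p. \<forall>v \<in> tangent_space A p. \<forall>w \<in> tangent_space A p. h p v w = - h p w v)"

text \<open>The map \<open>h : TM \<rightarrow> T*M\<close>, \<open>h(X) = h(X, \<cdot>)\<close>, and its inverse, applied fibrewise to sections.\<close>

definition flat :: "('a, 'n::finite) atlas \<Rightarrow> 'a tensor2 \<Rightarrow> 'a vfield \<Rightarrow> 'a form1" where
  "flat A h X = (\<lambda>p w. if w \<in> tangent_space A p then h p (X p) w else 0)"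

definition sharp :: "('a, 'n::finite) atlas \<Rightarrow> 'a tensor2 \<Rightarrow> 'a form1 \<Rightarrow> 'a vfield" where
  "sharp A h \<alpha> =
     (\<lambda>p. THE v. v \<in> tangent_space A p \<and> (\<forall>w \<in> tangent_space A p. h p v w = \<alpha> p w))"


section \<open>Affine connections and quasi-statistical manifolds\<close>

definition sec_add :: "('a \<Rightarrow> 'b \<Rightarrow> real) \<Rightarrow> ('a \<Rightarrow> 'b \<Rightarrow> real) \<Rightarrow> 'a \<Rightarrow> 'b \<Rightarrow> real" where
  "sec_add s t = (\<lambda>p x. s p x + t p x)"

definition sec_scale :: "('a \<Rightarrow> real) \<Rightarrow> ('a \<Rightarrow> 'b \<Rightarrow> real) \<Rightarrow> 'a \<Rightarrow> 'b \<Rightarrow> real" where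
  "sec_scale u s = (\<lambda>p x. u p * s p x)"

type_synonym 'a conn = "'a vfield \<Rightarrow> 'a vfield \<Rightarrow> 'a vfield"

definition affine_connection :: "('a, 'n::finite) atlas \<Rightarrow> 'a conn \<Rightarrow> bool" where
  "affine_connection A D \<longleftrightarrow>
     (\<forall>X \<in> vector_fields A. \<forall>Y \<in> vector_fields A. D X Y \<in> vector_fields A) \<and>
     (\<forall>X \<in> vector_fields A. \<forall>Y \<in> vector_fields A. \<forall>Z \<in> vector_fields A.
        D (sec_add X Y) Z = sec_add (D X Z) (D Y Z) \<and>
        D X (sec_add Y Z) = sec_add (D X Y) (D X Z)) \<and>
     (\<forall>u \<in> smooth_functions A. \<forall>X \<in> vector_fields A. \<forall>Y \<in> vector_fields A.
        D (sec_scale u X) Y = sec_scale u (D X Y) \<and>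
        D X (sec_scale u Y) = sec_add (sec_scale (\<lambda>p. X p u) Y) (sec_scale u (D X Y)))"

definition lie_bracket :: "'a vfield \<Rightarrow> 'a vfield \<Rightarrow> 'a vfield" where
  "lie_bracket X Y = (\<lambda>p f. X p (\<lambda>q. Y q f) - Y p (\<lambda>q. X q f))"

definition torsion :: "'a conn \<Rightarrow> 'a vfield \<Rightarrow> 'a vfield \<Rightarrow> 'a vfield" where
  "torsion D X Y = (\<lambda>p f. D X Y p f - D Y X p f - lie_bracket X Y p f)"

definition cov_tensor ::
  "'a conn \<Rightarrow> 'a vfield \<Rightarrow> 'a tensor2 \<Rightarrow> 'a vfield \<Rightarrow> 'a vfield \<Rightarrow> 'a \<Rightarrow> real" where
  "cov_tensor D X h Y Z =
     (\<lambda>p. X p (\<lambda>q. h q (Y q) (Z q)) - h p (D X Y p) (Z p) - h p (Y p) (D X Z p))"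

text \<open>\<open>\<nabla>\<^sub>X\<beta>\<close> is the 1-form whose value on every vector field \<open>Y\<close> is \<open>X(\<beta>(Y)) - \<beta>(\<nabla>\<^sub>XY)\<close>.\<close>

definition cov_form ::
  "('a, 'n::finite) atlas \<Rightarrow> 'a conn \<Rightarrow> 'a vfield \<Rightarrow> 'a form1 \<Rightarrow> 'a form1" where
  "cov_form A D X \<beta> =
     (THE \<theta>. \<theta> \<in> one_forms A \<and>
        (\<forall>Y \<in> vector_fields A. \<forall>p.
           \<theta> p (Y p) = X p (\<lambda>q. \<beta> q (Y q)) - \<beta> p (D X Y p)))"

definition quasi_statistical_manifold ::
  "('a::{t2_space, second_countable_topology}, 'n::finite) atlas \<Rightarrow> 'a tensor2 \<Rightarrow> 'a conn \<Rightarrow> bool" where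
  "quasi_statistical_manifold A h D \<longleftrightarrow>
     smooth_manifold A \<and> h \<in> tensor_fields2 A \<and> nondegenerate A h \<and> affine_connection A D \<and>
     (\<forall>X \<in> vector_fields A. \<forall>Y \<in> vector_fields A. \<forall>Z \<in> vector_fields A. \<forall>p.
        cov_tensor D X h Y Z p - cov_tensor D Y h X Z p + h p (torsion D X Y p) (Z p) = 0)"


section \<open>The generalized tangent bundle\<close>

text \<open>A section \<open>X + \<alpha>\<close> of \<open>TM \<oplus> T*M\<close> is the pair \<open>(X, \<alpha>)\<close>.\<close>

type_synonym 'a gsec = "'a vfield \<times> 'a form1"

abbreviation gen_sections :: "('a, 'n::finite) atlas \<Rightarrow> 'a gsec set" where
  "gen_sections A \<equiv> vector_fields A \<times> one_forms A"

definition check_h ::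
  "('a, 'n::finite) atlas \<Rightarrow> 'a tensor2 \<Rightarrow> 'a gsec \<Rightarrow> 'a gsec \<Rightarrow> 'a \<Rightarrow> real" where
  "check_h A h = (\<lambda>(X, \<alpha>) (Y, \<beta>) p.
     h p (X p) (Y p) + h p (sharp A h \<alpha> p) (sharp A h \<beta> p))"

text \<open>The second branch is meant for skew-symmetric \<open>h\<close>; a non-degenerate \<open>h\<close> cannot be both
  symmetric and skew-symmetric, as the dimension is positive.\<close>

definition hat_h ::
  "('a, 'n::finite) atlas \<Rightarrow> 'a tensor2 \<Rightarrow> 'a gsec \<Rightarrow> 'a gsec \<Rightarrow> 'a \<Rightarrow> real" where
  "hat_h A h = (\<lambda>(X, \<alpha>) (Y, \<beta>) p.
     if symmetric_tensor A h then - (1/2) * (\<alpha> p (Y p) + \<beta> p (X p))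
     else - (1/2) * (\<alpha> p (Y p) - \<beta> p (X p)))"

definition hat_nabla ::
  "('a, 'n::finite) atlas \<Rightarrow> 'a tensor2 \<Rightarrow> 'a conn \<Rightarrow> 'a gsec \<Rightarrow> 'a gsec \<Rightarrow> 'a gsec" where
  "hat_nabla A h D = (\<lambda>(X, \<alpha>) (Y, \<beta>). (D X Y, flat A h (D X (sharp A h \<beta>))))"

text \<open>\<open>is_dual_value A b G \<sigma> \<nu> \<mu>\<close>: the section \<open>\<mu>\<close> satisfies the equation that defines \<open>G*\<^sub>\<sigma>\<nu>\<close>, where
  \<open>G*\<close> is the dual with respect to the bilinear form \<open>b\<close> of the connection \<open>G\<close> on \<open>TM \<oplus> T*M\<close>;
  \<open>dual_connection A b G\<close> is \<open>G*\<close>.\<close>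

definition is_dual_value ::
  "('a, 'n::finite) atlas \<Rightarrow> ('a gsec \<Rightarrow> 'a gsec \<Rightarrow> 'a \<Rightarrow> real) \<Rightarrow> ('a gsec \<Rightarrow> 'a gsec \<Rightarrow> 'a gsec)
     \<Rightarrow> 'a gsec \<Rightarrow> 'a gsec \<Rightarrow> 'a gsec \<Rightarrow> bool" where
  "is_dual_value A b G \<sigma> \<nu> \<mu> \<longleftrightarrow> \<mu> \<in> gen_sections A \<and>
     (\<forall>\<tau> \<in> gen_sections A. \<forall>p. b \<tau> \<mu> p = fst \<sigma> p (b \<tau> \<nu>) - b (G \<sigma> \<tau>) \<nu> p)"

definition dual_connection ::
  "('a, 'n::finite) atlas \<Rightarrow> ('a gsec \<Rightarrow> 'a gsec \<Rightarrow> 'a \<Rightarrow> real) \<Rightarrow> ('a gsec \<Rightarrow> 'a gsec \<Rightarrow> 'a gsec)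
     \<Rightarrow> 'a gsec \<Rightarrow> 'a gsec \<Rightarrow> 'a gsec" where
  "dual_connection A b G = (\<lambda>\<sigma> \<nu>.
     if \<sigma> \<in> gen_sections A \<and> \<nu> \<in> gen_sections A then THE \<mu>. is_dual_value A b G \<sigma> \<nu> \<mu>
     else undefined)"

end

theory Submission
  imports Defs
begin

text \<open>Since \<open>h\<close> is symmetric or skew-symmetric, \<open>h(W, h\<^sup>-\<^sup>1(\<nabla>\<^sub>X(h(Z)))) = \<plusminus> (\<nabla>\<^sub>X(h(Z)))(W)\<close>, which unfolds
  to \<open>X(h(W, Z)) - h(\<nabla>\<^sub>XW, Z)\<close>. Applied with \<open>W = Y\<close>, and with \<open>W = h\<^sup>-\<^sup>1(\<beta>)\<close> and \<open>Z\<close> or \<open>h\<^sup>-\<^sup>1(\<gamma>)\<close>, this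
  identity gives the equations that define both dual connections; non-degeneracy makes their solutions
  unique.

  As tangent vectors are derivations, the analytic content is that they form a space of dimension
  \<open>CARD('n)\<close> with smooth local frames of globally defined vector fields: this makes \<open>h\<^sup>-\<^sup>1\<close> exist and
  (by Cramer's rule) preserve smoothness, and makes \<open>\<nabla>\<^sub>X\<beta>\<close> a 1-form.\<close>


section \<open>Calculus of smooth functions on open sets\<close>

text \<open>Tangent vectors act on globally smooth functions and are 0 on all others, so an object
  known only on one chart cannot be handed to a derivation. Coordinates, coordinate fields and
  Hadamard coefficients are therefore multiplied by bump functions that vanish off a closed subset
  of their domain, and locality of derivations shows that the values near the point do not change.
  Hadamard's lemma must deliver smooth coefficients and not merely a small remainder, because the
  derivation is applied to products containing them; this is what forces differentiation under the
  integral sign. \<open>sharp\<close>, \<open>cov_form\<close> and \<open>dual_connection\<close>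
  are definite descriptions, so each needs existence and uniqueness before its defining equation can
  be used. For the dual connections existence comes from exhibiting the closed formula as a
  solution. The symmetric and the skew-symmetric case run together: exchanging the slots of
  \<open>h\<close> costs a sign \<open>s\<close>, and the central identity exchanges them
  twice.\<close>

lemma Ck_on_derivative:
  assumes "Ck_on (Suc k) S f" "open S" "x \<in> S"
  shows "(f has_derivative frechet_derivative f (at x)) (at x)"
  using assms by (simp add: differentiable_on_eq_differentiable_at frechet_derivative_works)

text \<open>The derivatives are taken at \<open>at x\<close>, not within \<open>S\<close>, so
  agreement on \<open>S\<close> suffices only because an open \<open>S\<close> is a neighbourhood of
  each of its points.\<close>

lemma Ck_on_cong:
  assumes "open S" and "\<And>x. x \<in> S \<Longrightarrow> f x = g x" and "Ck_on k S f"
  shows "Ck_on k S g"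
  using assms(2,3)
proof (induction k arbitrary: f g)
  case 0
  then show ?case using continuous_on_eq by auto
next
  case (Suc k)
  have g': "(g has_derivative frechet_derivative f (at x)) (at x)" if "x \<in> S" for x
    using Ck_on_derivative[OF Suc.prems(2) \<open>open S\<close> that] \<open>open S\<close> that Suc.prems(1)
    by (rule has_derivative_transform_within_open)
  have "Ck_on k S (\<lambda>x. frechet_derivative g (at x) v)" for v
    by (rule Suc.IH[of "\<lambda>x. frechet_derivative f (at x) v"])
      (use Suc.prems(2) in \<open>simp_all add: frechet_derivative_at[OF g', symmetric]\<close>)
  moreover have "g differentiable_on S"
    using g' \<open>open S\<close> by (auto simp: differentiable_on_eq_differentiable_at differentiable_def)
  ultimately show ?case by simp
qed

text \<open>Derivatives are unique, so \<open>frechet_derivative\<close> may be replaced by any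
  explicit formula \<open>f'\<close>. The closure rules below thereby reduce to a derivative rule
  plus the induction hypothesis.\<close>

lemma Ck_on_Suc_derivI:
  assumes "open S" and f': "\<And>x. x \<in> S \<Longrightarrow> (f has_derivative f' x) (at x)"
    and "\<And>v. Ck_on k S (\<lambda>x. f' x v)"
  shows "Ck_on (Suc k) S f"
proof -
  have "Ck_on k S (\<lambda>x. frechet_derivative f (at x) v)" for v
    by (rule Ck_on_cong[OF \<open>open S\<close> _ assms(3)[of v]]) (simp add: frechet_derivative_at[OF f', symmetric])
  moreover have "f differentiable_on S"
    using f' \<open>open S\<close> by (auto simp: differentiable_on_eq_differentiable_at differentiable_def)
  ultimately show ?thesis by simp
qed

lemma Ck_on_subset: "Ck_on k S f \<Longrightarrow> T \<subseteq> S \<Longrightarrow> Ck_on k T f"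
  by (induction k arbitrary: f) (auto intro: continuous_on_subset differentiable_on_subset)

lemma Ck_on_Suc_imp: "Ck_on (Suc k) S f \<Longrightarrow> Ck_on k S f"
  by (induction k arbitrary: f) (auto intro: differentiable_imp_continuous_on)

lemma Ck_on_continuous: "Ck_on k S f \<Longrightarrow> continuous_on S f"
  by (cases k) (auto intro: differentiable_imp_continuous_on)

lemma Ck_on_local:
  assumes "open S" and "\<And>x. x \<in> S \<Longrightarrow> \<exists>T. open T \<and> x \<in> T \<and> Ck_on k T f"
  shows "Ck_on k S f"
  using assms(2)
proof (induction k arbitrary: f)
  case 0
  have "isCont f x" if "x \<in> S" for x
    using 0[OF that] by (auto simp: continuous_on_eq_continuous_at)
  then show ?case
    by (simp add: continuous_at_imp_continuous_on)
next
  case (Suc k)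
  have "f differentiable at x" if "x \<in> S" for x
    using Suc.prems[OF that] by (auto simp: differentiable_on_eq_differentiable_at)
  moreover have "Ck_on k S (\<lambda>x. frechet_derivative f (at x) v)" for v
    by (rule Suc.IH) (metis Suc.prems Ck_on.simps(2))
  ultimately show ?case
    using \<open>open S\<close> by (simp add: differentiable_on_eq_differentiable_at)
qed

lemma Ck_on_const: "Ck_on k S (\<lambda>_. c)"
proof (induction k arbitrary: c)
  case (Suc k)
  then show ?case
    by (simp add: frechet_derivative_const differentiable_on_const)
qed simp

lemma Ck_on_bounded_linear_comp:
  assumes "open S" "bounded_linear L" "Ck_on k S f"
  shows "Ck_on k S (\<lambda>x. L (f x))"
  using assms(3)
proof (induction k arbitrary: f)
  case 0
  then show ?case
    using linear_continuous_on[OF assms(2), of UNIV] by (auto intro: continuous_on_compose2)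
next
  case (Suc k)
  then show ?case
    by (intro Ck_on_Suc_derivI[where f' = "\<lambda>x v. L (frechet_derivative f (at x) v)"] \<open>open S\<close>
        bounded_linear.has_derivative[OF assms(2)] Ck_on_derivative[OF Suc.prems]) auto
qed

lemma Ck_on_ident:
  assumes "open S"
  shows "Ck_on k S (\<lambda>x. x)"
proof (cases k)
  case (Suc k)
  then show ?thesis
    by (auto intro!: Ck_on_Suc_derivI[where f' = "\<lambda>x v. v"] Ck_on_const assms)
qed simp

lemma Ck_on_linear:
  assumes "open S" "bounded_linear L"
  shows "Ck_on k S L"
  using Ck_on_bounded_linear_comp[OF assms Ck_on_ident[OF assms(1)]] .

lemma Ck_on_add:
  assumes "open S" "Ck_on k S f" "Ck_on k S g"
  shows "Ck_on k S (\<lambda>x. f x + g x)"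
  using assms(2,3)
proof (induction k arbitrary: f g)
  case 0
  then show ?case by (auto intro: continuous_intros)
next
  case (Suc k)
  show ?case
    by (rule Ck_on_Suc_derivI[OF \<open>open S\<close>,
          where f' = "\<lambda>x v. frechet_derivative f (at x) v + frechet_derivative g (at x) v"])
      (use Suc in \<open>auto intro!: has_derivative_add Ck_on_derivative[OF Suc.prems(1)]
         Ck_on_derivative[OF Suc.prems(2)] \<open>open S\<close>\<close>)
qed

lemma Ck_on_mult:
  fixes f g :: "'e::euclidean_space \<Rightarrow> real"
  assumes "open S" "Ck_on k S f" "Ck_on k S g"
  shows "Ck_on k S (\<lambda>x. f x * g x)"
  using assms(2,3)
proof (induction k arbitrary: f g)
  case 0
  then show ?case by (auto intro: continuous_intros)
next
  case (Suc k)
  show ?case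
    by (rule Ck_on_Suc_derivI[OF \<open>open S\<close>, where
          f' = "\<lambda>x v. f x * frechet_derivative g (at x) v + frechet_derivative f (at x) v * g x"])
      (use Suc Ck_on_Suc_imp[OF Suc.prems(1)] Ck_on_Suc_imp[OF Suc.prems(2)] in
        \<open>auto intro!: has_derivative_mult Ck_on_derivative[OF Suc.prems(1)]
          Ck_on_derivative[OF Suc.prems(2)] Ck_on_add \<open>open S\<close>\<close>)
qed

lemma Ck_on_sum:
  assumes "open S" "\<And>i. i \<in> I \<Longrightarrow> Ck_on k S (f i)"
  shows "Ck_on k S (\<lambda>x. \<Sum>i\<in>I. f i x)"
proof (cases "finite I")
  case True
  then show ?thesis
    using assms(2) by (induction I) (auto intro: Ck_on_const Ck_on_add[OF \<open>open S\<close>])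
qed (simp add: Ck_on_const)

lemma Ck_on_inverse:
  fixes f :: "'e::euclidean_space \<Rightarrow> real"
  assumes "open S" "Ck_on k S f" and nz: "\<And>x. x \<in> S \<Longrightarrow> f x \<noteq> 0"
  shows "Ck_on k S (\<lambda>x. inverse (f x))"
  using assms(2)
proof (induction k)
  case 0
  then show ?case using nz by (auto intro: continuous_intros)
next
  case (Suc k)
  have inv: "Ck_on k S (\<lambda>x. inverse (f x))"
    using Suc Ck_on_Suc_imp by blast
  \<comment> \<open>The derivative contains the reciprocal itself, and only its regularity of order
    \<open>k\<close> is needed here, which \<open>inv\<close> supplies.\<close>
  have "Ck_on k S (\<lambda>x. - 1 * (inverse (f x) * frechet_derivative f (at x) v * inverse (f x)))" for v
    using Suc.prems inv by (intro Ck_on_mult Ck_on_const \<open>open S\<close>) auto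
  then show ?case
    by (intro Ck_on_Suc_derivI[OF \<open>open S\<close>, where
          f' = "\<lambda>x v. - (inverse (f x) * frechet_derivative f (at x) v * inverse (f x))"])
      (auto intro!: Deriv.has_derivative_inverse nz Ck_on_derivative[OF Suc.prems \<open>open S\<close>])
qed

lemma linear_Basis_sum:
  fixes L :: "'e::euclidean_space \<Rightarrow> real"
  assumes "linear L"
  shows "L v = (\<Sum>e\<in>Basis. (v \<bullet> e) * L e)"
proof -
  have "L v = L (\<Sum>e\<in>Basis. (v \<bullet> e) *\<^sub>R e)"
    by (simp only: euclidean_representation)
  then show ?thesis
    by (simp add: linear_sum[OF assms] linear_scale[OF assms])
qed

text \<open>In the chain rule both the base point and the direction of the derivative of
  \<open>g\<close> vary with \<open>x\<close>, whereas \<open>Ck_on\<close> controls fixed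
  directions only. Expanding the direction in the basis separates the two; \<open>g\<close> is
  generalised because the induction hypothesis is applied to its partial derivatives.\<close>

lemma Ck_on_compose:
  fixes f :: "'e::euclidean_space \<Rightarrow> 'f::euclidean_space" and g :: "'f \<Rightarrow> real"
  assumes "open S" "open T" "Ck_on k S f" "Ck_on k T g" "f ` S \<subseteq> T"
  shows "Ck_on k S (\<lambda>x. g (f x))"
  using assms(3,4)
proof (induction k arbitrary: g)
  case 0
  then show ?case using assms(5) by (auto intro: continuous_on_compose2)
next
  case (Suc k)
  let ?f' = "\<lambda>x. frechet_derivative f (at x)" and ?g' = "\<lambda>y. frechet_derivative g (at y)"
  have f': "(f has_derivative ?f' x) (at x)" if "x \<in> S" for x
    using Ck_on_derivative[OF Suc.prems(1) \<open>open S\<close> that] .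
  have g': "(g has_derivative ?g' (f x)) (at (f x))" if "x \<in> S" for x
    using Ck_on_derivative[OF Suc.prems(2) \<open>open T\<close>] that assms(5) by blast
  have expand: "?g' (f x) (?f' x v) = (\<Sum>e\<in>Basis. (?f' x v \<bullet> e) * ?g' (f x) e)"
    if "x \<in> S" for x v
    by (rule linear_Basis_sum[OF has_derivative_linear[OF g'[OF that]]])
  have "Ck_on k S (\<lambda>x. \<Sum>e\<in>Basis. (?f' x v \<bullet> e) * ?g' (f x) e)" for v
  proof (intro Ck_on_sum Ck_on_mult \<open>open S\<close>)
    fix e
    show "Ck_on k S (\<lambda>x. ?f' x v \<bullet> e)"
      using Suc.prems(1) by (intro Ck_on_bounded_linear_comp[OF \<open>open S\<close> bounded_linear_inner_left]) auto
    show "Ck_on k S (\<lambda>x. ?g' (f x) e)"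
      by (rule Suc.IH) (use Suc.prems Ck_on_Suc_imp in auto)
  qed
  then have "Ck_on k S (\<lambda>x. ?g' (f x) (?f' x v))" for v
    by (rule Ck_on_cong[OF \<open>open S\<close>, rotated]) (simp add: expand)
  then show ?case
    by (intro Ck_on_Suc_derivI[OF \<open>open S\<close>, where f' = "\<lambda>x v. ?g' (f x) (?f' x v)"])
      (auto intro: diff_chain_at[OF f' g', unfolded o_def])
qed

section \<open>Passage from finite order to smooth functions\<close>

lemma smooth_on_cong: "open S \<Longrightarrow> smooth_on S f \<Longrightarrow> (\<And>x. x \<in> S \<Longrightarrow> f x = g x) \<Longrightarrow> smooth_on S g"
  unfolding smooth_on_def using Ck_on_cong by blast

lemma smooth_on_subset: "smooth_on S f \<Longrightarrow> T \<subseteq> S \<Longrightarrow> smooth_on T f"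
  unfolding smooth_on_def using Ck_on_subset by blast

lemma smooth_on_local:
  assumes "open S" "\<And>x. x \<in> S \<Longrightarrow> \<exists>T. open T \<and> x \<in> T \<and> smooth_on T f"
  shows "smooth_on S f"
  using assms unfolding smooth_on_def by (meson Ck_on_local)

lemma smooth_on_const: "smooth_on S (\<lambda>_. c)"
  by (simp add: smooth_on_def Ck_on_const)

lemma smooth_on_linear: "open S \<Longrightarrow> bounded_linear L \<Longrightarrow> smooth_on S L"
  by (simp add: smooth_on_def Ck_on_linear)

lemma smooth_on_add:
  "open S \<Longrightarrow> smooth_on S f \<Longrightarrow> smooth_on S g \<Longrightarrow> smooth_on S (\<lambda>x. f x + g x)"
  by (simp add: smooth_on_def Ck_on_add)

lemma smooth_on_mult:
  fixes f g :: "'e::euclidean_space \<Rightarrow> real"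
  shows "open S \<Longrightarrow> smooth_on S f \<Longrightarrow> smooth_on S g \<Longrightarrow> smooth_on S (\<lambda>x. f x * g x)"
  by (simp add: smooth_on_def Ck_on_mult)

lemma smooth_on_inverse:
  fixes f :: "'e::euclidean_space \<Rightarrow> real"
  shows "open S \<Longrightarrow> smooth_on S f \<Longrightarrow> (\<And>x. x \<in> S \<Longrightarrow> f x \<noteq> 0) \<Longrightarrow> smooth_on S (\<lambda>x. inverse (f x))"
  by (simp add: smooth_on_def Ck_on_inverse)

lemma smooth_on_compose:
  fixes f :: "'e::euclidean_space \<Rightarrow> 'f::euclidean_space" and g :: "'f \<Rightarrow> real"
  assumes "open S" "open T" "smooth_on S f" "smooth_on T g" "f ` S \<subseteq> T"
  shows "smooth_on S (\<lambda>x. g (f x))"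
  using assms by (simp add: smooth_on_def Ck_on_compose[OF assms(1,2)])

lemma smooth_on_derivative:
  "smooth_on S f \<Longrightarrow> open S \<Longrightarrow> x \<in> S \<Longrightarrow> (f has_derivative frechet_derivative f (at x)) (at x)"
  unfolding smooth_on_def using Ck_on_derivative by blast

lemma smooth_on_frechet_derivative:
  "smooth_on S f \<Longrightarrow> smooth_on S (\<lambda>x. frechet_derivative f (at x) v)"
  unfolding smooth_on_def by (metis Ck_on.simps(2))

lemma smooth_on_continuous: "smooth_on S f \<Longrightarrow> continuous_on S f"
  unfolding smooth_on_def using Ck_on_continuous by blast


subsection \<open>Bump functions\<close>

text \<open>The factor \<open>t\<^sup>-\<^sup>m\<close> makes the family closed under differentiation.\<close>

definition flat_exp :: "nat \<Rightarrow> real \<Rightarrow> real" where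
  "flat_exp m t = (if t > 0 then inverse t ^ m * exp (- inverse t) else 0)"

lemma flat_exp_tendsto_0: "(flat_exp m \<longlongrightarrow> 0) (at 0)"
proof -
  \<comment> \<open>With \<open>u = inverse t\<close> this is the decay of
    \<open>u ^ m / exp u\<close> as \<open>u\<close> tends to infinity.\<close>
  have "((\<lambda>t. inverse t ^ m / exp (inverse t)) \<longlongrightarrow> (0::real)) (at_right 0)"
    by (rule filterlim_compose[OF tendsto_power_div_exp_0 filterlim_inverse_at_top_right])
  then have "(flat_exp m \<longlongrightarrow> 0) (at_right 0)"
    by (rule filterlim_cong[THEN iffD1, rotated 3])
      (auto simp: flat_exp_def exp_minus divide_inverse eventually_at_filter)
  moreover have "(flat_exp m \<longlongrightarrow> 0) (at_left 0)"
    by (rule tendsto_eventually) (auto simp: flat_exp_def eventually_at_filter)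
  ultimately show ?thesis
    by (simp add: filterlim_at_split)
qed

lemma flat_exp_has_derivative:
  "(flat_exp m has_real_derivative (flat_exp (m + 2) t - real m * flat_exp (m + 1) t)) (at t)"
proof (cases t "0::real" rule: linorder_cases)
  case less
  have "((\<lambda>_. 0) has_real_derivative 0) (at t)" by simp
  then show ?thesis
    by (rule has_field_derivative_transform_within_open[of _ _ _ "{..<0}", THEN DERIV_cong])
      (use less in \<open>auto simp: flat_exp_def\<close>)
next
  case equal
  \<comment> \<open>The difference quotient at 0 is the next member of the family, which tends to
    0.\<close>
  have "flat_exp m s / s = flat_exp (m + 1) s" for s
    by (simp add: flat_exp_def field_simps)
  then have "((\<lambda>s. (flat_exp m s - flat_exp m 0) / (s - 0)) \<longlongrightarrow> 0) (at 0)"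
    using flat_exp_tendsto_0[of "m + 1"] by (simp add: flat_exp_def[of _ 0])
  then show ?thesis
    using equal by (simp add: has_field_derivative_iff flat_exp_def)
next
  case greater
  have "((\<lambda>t. exp (- inverse t)) has_real_derivative inverse t ^ 2 * exp (- inverse t)) (at t)"
    using greater by (auto intro!: derivative_eq_intros simp: power2_eq_square)
  moreover have "((\<lambda>t. inverse t ^ m) has_real_derivative - real m * inverse t ^ (m + 1)) (at t)"
  proof (induction m)
    case (Suc m)
    show ?case
      using DERIV_mult[OF DERIV_inverse[of t] Suc] greater by (simp add: algebra_simps)
  qed simp
  ultimately have "((\<lambda>t. inverse t ^ m * exp (- inverse t)) has_real_derivative
      (flat_exp (m + 2) t - real m * flat_exp (m + 1) t)) (at t)"
    using greater
    using greater by (auto dest: DERIV_mult intro: DERIV_cong simp: flat_exp_def algebra_simps power2_eq_square)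
  then show ?thesis
    by (rule has_field_derivative_transform_within_open[of _ _ _ "{0<..}"])
      (use greater in \<open>auto simp: flat_exp_def\<close>)
qed

lemma smooth_on_flat_exp: "smooth_on UNIV (flat_exp m)"
proof -
  have "Ck_on k UNIV (flat_exp m)" for k
  proof (induction k arbitrary: m)
    case 0
    then show ?case
      using DERIV_isCont[OF flat_exp_has_derivative] by (simp add: continuous_at_imp_continuous_on)
  next
    case (Suc k)
    have "Ck_on k UNIV (\<lambda>t. (flat_exp (m + 2) t + (- real m) * flat_exp (m + 1) t) * v)" for v
      by (intro Ck_on_mult Ck_on_add Ck_on_const Suc open_UNIV)
    then show ?case
      using flat_exp_has_derivative[of m]
      by (intro Ck_on_Suc_derivI[where
            f' = "\<lambda>t v. (flat_exp (m + 2) t - real m * flat_exp (m + 1) t) * v"])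
        (auto simp: has_field_derivative_def)
  qed
  then show ?thesis by (simp add: smooth_on_def)
qed

text \<open>The quotient \<open>?f / (?f + ?g)\<close> of flat exponentials: \<open>?f\<close>
  vanishes outside the ball of radius \<open>2 * r\<close>, \<open>?g\<close> inside the one of
  radius \<open>r\<close>. As the radii differ, the two never vanish together.\<close>

lemma bump_function:
  fixes a :: "'e::euclidean_space"
  assumes "r > 0"
  obtains b :: "'e \<Rightarrow> real" where "smooth_on UNIV b" "\<And>x. dist a x \<le> r \<Longrightarrow> b x = 1"
    "\<And>x. dist a x \<ge> 2 * r \<Longrightarrow> b x = 0"
proof
  \<comment> \<open>The squared distance to \<open>a\<close>, spelled out with sums and products of
    coordinates so that the closure rules apply literally.\<close>
  let ?n = "\<lambda>x. \<Sum>e\<in>Basis. (x \<bullet> e + - (a \<bullet> e)) * (x \<bullet> e + - (a \<bullet> e))"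
  have n: "?n x = dist a x ^ 2" for x
    unfolding dist_norm norm_minus_commute[of a] power2_norm_eq_inner
    by (subst euclidean_inner) (simp add: inner_diff_left)
  let ?f = "\<lambda>x. flat_exp 0 (4 * r\<^sup>2 + - 1 * ?n x)" and ?g = "\<lambda>x. flat_exp 0 (?n x + - r\<^sup>2)"
  define b where "b x = ?f x * inverse (?f x + ?g x)" for x
  have pos: "?f x + ?g x \<noteq> 0" for x
  proof -
    have "4 * r\<^sup>2 - ?n x > 0 \<or> ?n x - r\<^sup>2 > 0"
      using \<open>r > 0\<close> by (smt (verit) zero_less_power)
    then show ?thesis
      by (auto simp: flat_exp_def add_pos_pos less_imp_neq[symmetric])
  qed
  have sn: "smooth_on UNIV ?n"
    unfolding smooth_on_def
    by (intro allI Ck_on_sum Ck_on_mult Ck_on_add Ck_on_const Ck_on_linear bounded_linear_inner_left)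
      auto
  have sf: "smooth_on UNIV ?f"
    by (intro smooth_on_compose[OF _ _ _ smooth_on_flat_exp] smooth_on_add
        smooth_on_mult[OF _ smooth_on_const] smooth_on_const sn) auto
  have sg: "smooth_on UNIV ?g"
    by (intro smooth_on_compose[OF _ _ _ smooth_on_flat_exp] smooth_on_add smooth_on_const sn) auto
  show "smooth_on UNIV b"
    unfolding b_def by (intro smooth_on_mult smooth_on_inverse smooth_on_add sf sg pos) auto
  show "b x = 1" if "dist a x \<le> r" for x
  proof -
    have "dist a x ^ 2 \<le> r ^ 2" using that by (simp add: power_mono)
    then have "?g x = 0" unfolding n by (simp add: flat_exp_def)
    then show ?thesis using pos[of x] by (simp add: b_def)
  qed
  show "b x = 0" if "dist a x \<ge> 2 * r" for x
  proof -
    have "(2 * r) ^ 2 \<le> dist a x ^ 2" using that \<open>r > 0\<close> by (intro power_mono) auto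
    then have "?f x = 0" unfolding n by (simp add: flat_exp_def power_mult_distrib)
    then show ?thesis by (simp add: b_def)
  qed
qed


subsection \<open>Hadamard's lemma\<close>

text \<open>Differentiating \<open>f (b + t *\<^sub>R (x - b))\<close> in \<open>x\<close> produces
  a factor \<open>t\<close>. The weight \<open>t ^ m\<close> with arbitrary \<open>m\<close> absorbs
  it, so the derivative is an integral of the same kind and the induction closes. Convexity keeps
  the segment inside \<open>S\<close>.\<close>

lemma Ck_on_segment_integral:
  fixes f :: "'e::euclidean_space \<Rightarrow> real"
  assumes "open S" "convex S" "b \<in> S" "Ck_on k S f"
  shows "Ck_on k S (\<lambda>x. integral (cbox 0 1) (\<lambda>t. t ^ m * f (b + t *\<^sub>R (x - b))))"
  using assms(4)
proof (induction k arbitrary: f m)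
  have seg: "b + t *\<^sub>R (x - b) \<in> S" if "x \<in> S" "t \<in> cbox 0 1" for x t
    using convexD_alt[OF \<open>convex S\<close> \<open>b \<in> S\<close> \<open>x \<in> S\<close>, of t] that by (simp add: algebra_simps)
  have cont: "continuous_on (S \<times> cbox 0 1) (\<lambda>(x, t). t ^ m * f (b + t *\<^sub>R (x - b)))"
    if "continuous_on S f" for f :: "'e \<Rightarrow> real" and m
    unfolding split_beta
    by (intro continuous_intros continuous_on_compose2[OF that]) (auto simp: seg)
  {
    case 0
    then show ?case using cont integral_continuous_on_param by fastforce
  next
    case (Suc k)
    let ?f' = "\<lambda>x. frechet_derivative f (at x)"
    \<comment> \<open>\<open>leibniz_rule\<close> expects the derivative as a jointly continuous
      family of bounded linear maps. \<open>Blinfun\<close> is meaningful only where its argument is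
      bounded linear, here for \<open>x\<close> in \<open>S\<close> and \<open>t\<close> between 0
      and 1.\<close>
    define D where "D x t = Blinfun (\<lambda>v. t ^ Suc m * ?f' (b + t *\<^sub>R (x - b)) v)" for x t
    have f': "(f has_derivative ?f' y) (at y)" if "y \<in> S" for y
      using Ck_on_derivative[OF Suc.prems \<open>open S\<close> that] .
    have D: "blinfun_apply (D x t) v = t ^ Suc m * ?f' (b + t *\<^sub>R (x - b)) v"
      if "x \<in> S" "t \<in> cbox 0 1" for x t v
      unfolding D_def
      by (subst bounded_linear_Blinfun_apply)
        (use has_derivative_bounded_linear[OF f'[OF seg[OF that]]] in
          \<open>auto intro: bounded_linear_const_mult simp del: power_Suc\<close>)
    have cD: "continuous_on (S \<times> cbox 0 1) (\<lambda>(x, t). D x t)"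
      unfolding split_beta
    proof (rule continuous_on_blinfun_componentwise)
      fix e :: 'e
      have "continuous_on S (\<lambda>y. ?f' y e)"
        using Suc.prems Ck_on_continuous by auto
      from cont[OF this, of "Suc m"]
      show "continuous_on (S \<times> cbox 0 1) (\<lambda>z. blinfun_apply (D (fst z) (snd z)) e)"
        by (rule continuous_on_cong[THEN iffD1, rotated 2]) (auto simp: D split_beta simp del: power_Suc)
    qed
    have der: "((\<lambda>x. integral (cbox 0 1) (\<lambda>t. t ^ m * f (b + t *\<^sub>R (x - b))))
        has_derivative blinfun_apply (integral (cbox 0 1) (D x))) (at x)" if "x \<in> S" for x
    proof -
      have "((\<lambda>x. integral (cbox 0 1) (\<lambda>t. t ^ m * f (b + t *\<^sub>R (x - b))))
        has_derivative blinfun_apply (integral (cbox 0 1) (D x))) (at x within S)"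
      proof (rule leibniz_rule[OF _ _ cD that \<open>convex S\<close>])
        fix x t assume xt: "x \<in> S" "t \<in> cbox (0::real) 1"
        have "((\<lambda>x. f (b + t *\<^sub>R (x - b))) has_derivative (\<lambda>v. ?f' (b + t *\<^sub>R (x - b)) (t *\<^sub>R v))) (at x)"
          by (rule has_derivative_compose[where g = f and f = "\<lambda>x. b + t *\<^sub>R (x - b)", 
                OF _ f'[OF seg[OF xt]]])
            (auto intro!: derivative_eq_intros)
        then have "((\<lambda>x. t ^ m * f (b + t *\<^sub>R (x - b))) has_derivative
            (\<lambda>v. t ^ m * ?f' (b + t *\<^sub>R (x - b)) (t *\<^sub>R v))) (at x)"
          by (rule has_derivative_mult_right)
        \<comment> \<open>Linearity pulls \<open>t\<close> out of the direction: this is where the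
          exponent rises to \<open>Suc m\<close>.\<close>
        moreover have "(\<lambda>v. t ^ m * ?f' (b + t *\<^sub>R (x - b)) (t *\<^sub>R v)) = blinfun_apply (D x t)"
          using linear_scale[OF has_derivative_linear[OF f'[OF seg[OF xt]]]]
          by (auto simp: D[OF xt] mult_ac)
        ultimately show "((\<lambda>x. t ^ m * f (b + t *\<^sub>R (x - b))) has_derivative
            blinfun_apply (D x t)) (at x within S)"
          by (simp add: has_derivative_at_withinI)
      next
        fix x assume "x \<in> S"
        then have "continuous_on (cbox 0 1) (\<lambda>t. t ^ m * f (b + t *\<^sub>R (x - b)))"
          by (intro continuous_intros continuous_on_compose2[OF Ck_on_continuous[OF Suc.prems]])
            (auto intro!: seg)
        then show "(\<lambda>t. t ^ m * f (b + t *\<^sub>R (x - b))) integrable_on cbox 0 1"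
          by (rule integrable_continuous)
      qed
      then show ?thesis by (simp only: at_within_open[OF that \<open>open S\<close>])
    qed
    have apply_int: "blinfun_apply (integral (cbox 0 1) (D x)) v =
        integral (cbox 0 1) (\<lambda>t. t ^ Suc m * ?f' (b + t *\<^sub>R (x - b)) v)" if "x \<in> S" for x v
    proof -
      have "continuous_on (cbox 0 1) (\<lambda>t. (\<lambda>(x, t). D x t) (x, t))"
        by (rule continuous_on_compose2[OF cD]) (use that in \<open>auto intro: continuous_intros\<close>)
      then have "continuous_on (cbox 0 1) (D x)" by simp
      then have "D x integrable_on cbox 0 1" by (rule integrable_continuous)
      then show ?thesis
        using integral_cong[OF D[OF that]] by (simp only: blinfun_apply_integral)
    qed
    have "Ck_on k S (\<lambda>x. blinfun_apply (integral (cbox 0 1) (D x)) v)" for v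
      by (rule Ck_on_cong[OF \<open>open S\<close> _ Suc.IH[of "\<lambda>y. ?f' y v" "Suc m"]])
        (use Suc.prems apply_int in \<open>auto simp del: power_Suc\<close>)
    then show ?case
      using der by (intro Ck_on_Suc_derivI[OF \<open>open S\<close>])
  }
qed

text \<open>The fundamental theorem of calculus along the segment from \<open>b\<close> to
  \<open>x\<close>, with the derivative in direction \<open>x - b\<close> expanded in the basis. At
  \<open>x = b\<close> the integrand is constant in \<open>t\<close>, which gives the value of the
  coefficient.\<close>

lemma Hadamard:
  fixes f :: "'e::euclidean_space \<Rightarrow> real"
  assumes "open S" "convex S" "b \<in> S" "smooth_on S f"
  obtains g where "\<And>e. smooth_on S (g e)" "\<And>e. g e b = frechet_derivative f (at b) e"
    "\<And>x. x \<in> S \<Longrightarrow> f x = f b + (\<Sum>e\<in>Basis. ((x - b) \<bullet> e) * g e x)"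
proof
  let ?f' = "\<lambda>x. frechet_derivative f (at x)"
  define g where "g e x = integral (cbox 0 1) (\<lambda>t. t ^ 0 * ?f' (b + t *\<^sub>R (x - b)) e)" for e x
  show sg: "smooth_on S (g e)" for e
    using smooth_on_frechet_derivative[OF assms(4), of e]
    unfolding smooth_on_def g_def by (intro allI Ck_on_segment_integral[OF assms(1-3)]) auto
  show "g e b = ?f' b e" for e
    by (simp add: g_def)
  fix x assume "x \<in> S"
  have seg: "b + t *\<^sub>R (x - b) \<in> S" if "t \<in> cbox 0 1" for t
    using convexD_alt[OF \<open>convex S\<close> \<open>b \<in> S\<close> \<open>x \<in> S\<close>, of t] that by (simp add: algebra_simps)
  note f' = smooth_on_derivative[OF assms(4,1)]
  have expand: "?f' y (x - b) = (\<Sum>e\<in>Basis. ((x - b) \<bullet> e) * ?f' y e)" if "y \<in> S" for y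
    by (rule linear_Basis_sum[OF has_derivative_linear[OF f'[OF that]]])
  have "((\<lambda>t. ?f' (b + t *\<^sub>R (x - b)) (x - b)) has_integral
      f (b + 1 *\<^sub>R (x - b)) - f (b + 0 *\<^sub>R (x - b))) {0..1}"
  proof (rule fundamental_theorem_of_calculus)
    fix t :: real assume "t \<in> {0..1}"
    then have "b + t *\<^sub>R (x - b) \<in> S" using seg by simp
    moreover have "((\<lambda>t. b + t *\<^sub>R (x - b)) has_vector_derivative (x - b)) (at t within {0..1})"
      by (auto intro!: derivative_eq_intros)
    ultimately show "((\<lambda>t. f (b + t *\<^sub>R (x - b))) has_vector_derivative
        ?f' (b + t *\<^sub>R (x - b)) (x - b)) (at t within {0..1})"
      using vector_derivative_diff_chain_within[of "\<lambda>t. b + t *\<^sub>R (x - b)" "x - b" t "{0..1}" f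
          "?f' (b + t *\<^sub>R (x - b))"] f'
      by (simp add: o_def has_derivative_at_withinI)
  qed simp
  then have "f x - f b = integral (cbox 0 1) (\<lambda>t. ?f' (b + t *\<^sub>R (x - b)) (x - b))"
    by (simp add: integral_unique)
  also have "\<dots> = integral (cbox 0 1) (\<lambda>t. \<Sum>e\<in>Basis. ((x - b) \<bullet> e) * ?f' (b + t *\<^sub>R (x - b)) e)"
    using expand seg by (intro integral_cong) auto
  also have "\<dots> = (\<Sum>e\<in>Basis. ((x - b) \<bullet> e) * g e x)"
  proof (subst integral_sum)
    fix e :: 'e
    have "continuous_on (cbox 0 1) (\<lambda>t. ?f' (b + t *\<^sub>R (x - b)) e)"
      by (rule continuous_on_compose2[OF smooth_on_continuous[OF smooth_on_frechet_derivative[OF assms(4)]]])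
        (auto intro!: continuous_intros seg)
    then show "(\<lambda>t. ((x - b) \<bullet> e) * ?f' (b + t *\<^sub>R (x - b)) e) integrable_on cbox 0 1"
      by (intro integrable_continuous continuous_intros)
  qed (auto simp: g_def)
  finally show "f x = f b + (\<Sum>e\<in>Basis. ((x - b) \<bullet> e) * g e x)" by simp
qed


section \<open>Smooth functions and tangent vectors on a manifold\<close>

text \<open>Functions stay total; for open \<open>N\<close> only their values on \<open>N\<close>
  matter, so locally meaningful formulas need no restriction or extension.\<close>

definition smooth_fun_on :: "('a, 'n::finite) atlas \<Rightarrow> 'a set \<Rightarrow> ('a \<Rightarrow> real) \<Rightarrow> bool" where
  "smooth_fun_on A N f \<longleftrightarrow> (\<forall>(U, \<phi>) \<in> A. smooth_on (\<phi> ` (U \<inter> N)) (f \<circ> inv_into U \<phi>))"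

lemma smooth_functions_iff: "f \<in> smooth_functions A \<longleftrightarrow> smooth_fun_on A UNIV f"
  by (simp add: smooth_functions_def smooth_fun_on_def)

lemma smooth_fun_on_subset: "smooth_fun_on A N f \<Longrightarrow> M \<subseteq> N \<Longrightarrow> smooth_fun_on A M f"
  unfolding smooth_fun_on_def by (fast intro: smooth_on_subset)

lemma smooth_functions_on: "f \<in> smooth_functions A \<Longrightarrow> smooth_fun_on A N f"
  unfolding smooth_functions_iff by (rule smooth_fun_on_subset) auto

lemma smooth_fun_on_const: "smooth_fun_on A N (\<lambda>_. c)"
  by (simp add: smooth_fun_on_def o_def smooth_on_const split_beta)

lemma sum_Basis_axis: "(\<Sum>e\<in>(Basis :: (real ^ 'n) set). P e) = (\<Sum>i\<in>UNIV. P (axis i 1))"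
  by (simp add: Basis_vec_def UNION_singleton_eq_range sum.reindex axis_eq_axis inj_on_def)

locale smooth_atlas =
  fixes A :: "('a::{t2_space, second_countable_topology}, 'n::finite) atlas"
  assumes smooth_manifold: "smooth_manifold A"
begin

section \<open>Charts and locally smooth functions\<close>

lemma chart_homeomorphism:
  assumes "(U, \<phi>) \<in> A"
  shows "open U" "open (\<phi> ` U)" "homeomorphism U (\<phi> ` U) \<phi> (inv_into U \<phi>)"
  using smooth_manifold assms by (auto simp: smooth_manifold_def)

lemma chart_inverse: "(U, \<phi>) \<in> A \<Longrightarrow> q \<in> U \<Longrightarrow> inv_into U \<phi> (\<phi> q) = q"
  using chart_homeomorphism(3) homeomorphism_apply1 by blast

lemma chart_at:
  obtains U \<phi> where "(U, \<phi>) \<in> A" "p \<in> U"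
  using smooth_manifold by (force simp: smooth_manifold_def)

lemma chart_image_open:
  assumes "(U, \<phi>) \<in> A" "open N"
  shows "open (\<phi> ` (U \<inter> N))"
proof -
  have "openin (top_of_set U) (U \<inter> N)"
    using assms(2) by (simp add: openin_open_Int)
  then show ?thesis
    using homeomorphism_imp_open_map[OF chart_homeomorphism(3)[OF assms(1)]]
      chart_homeomorphism(2)[OF assms(1)] openin_open_eq by blast
qed

lemma chart_preimage_open:
  assumes "(U, \<phi>) \<in> A" "open B"
  shows "open (U \<inter> \<phi> -` B)"
  using chart_homeomorphism[OF assms(1)] assms(2) homeomorphism_cont1
  by (intro continuous_open_preimage) blast+

lemma chart_image_preimage:
  assumes "(U, \<phi>) \<in> A" "B \<subseteq> \<phi> ` U"
  shows "\<phi> ` (U \<inter> \<phi> -` B) = B"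
  using assms by auto

lemma chart_image_mem:
  assumes "(U, \<phi>) \<in> A" "q \<in> U" "\<phi> q \<in> \<phi> ` (U \<inter> N)"
  shows "q \<in> N"
  using assms chart_inverse by (metis IntD1 IntD2 imageE)

lemma smooth_fun_on_cong:
  assumes "open N" "smooth_fun_on A N f" "\<And>q. q \<in> N \<Longrightarrow> f q = g q"
  shows "smooth_fun_on A N g"
  unfolding smooth_fun_on_def
proof safe
  fix U \<phi> assume chart: "(U, \<phi>) \<in> A"
  then have "smooth_on (\<phi> ` (U \<inter> N)) (f \<circ> inv_into U \<phi>)"
    using assms(2) by (auto simp: smooth_fun_on_def)
  then show "smooth_on (\<phi> ` (U \<inter> N)) (g \<circ> inv_into U \<phi>)"
    by (rule smooth_on_cong[OF chart_image_open[OF chart \<open>open N\<close>]])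
      (auto simp: chart_inverse[OF chart] assms(3))
qed

lemma smooth_fun_on_local:
  assumes "open N" "\<And>p. p \<in> N \<Longrightarrow> \<exists>M. open M \<and> p \<in> M \<and> smooth_fun_on A M f"
  shows "smooth_fun_on A N f"
  unfolding smooth_fun_on_def
proof safe
  fix U \<phi> assume chart: "(U, \<phi>) \<in> A"
  show "smooth_on (\<phi> ` (U \<inter> N)) (f \<circ> inv_into U \<phi>)"
  proof (rule smooth_on_local[OF chart_image_open[OF chart \<open>open N\<close>]])
    fix y assume "y \<in> \<phi> ` (U \<inter> N)"
    then obtain q where q: "y = \<phi> q" "q \<in> U" "q \<in> N" by auto
    then obtain M where "open M" "q \<in> M" "smooth_fun_on A M f" using assms(2) by blast
    then show "\<exists>T. open T \<and> y \<in> T \<and> smooth_on T (f \<circ> inv_into U \<phi>)"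
      using chart_image_open[OF chart] q chart
      by (intro exI[of _ "\<phi> ` (U \<inter> M)"]) (auto simp: smooth_fun_on_def)
  qed
qed

lemma smooth_functionsI:
  assumes "\<And>p. \<exists>M. open M \<and> p \<in> M \<and> smooth_fun_on A M f"
  shows "f \<in> smooth_functions A"
  unfolding smooth_functions_iff using assms by (intro smooth_fun_on_local) auto

lemma smooth_fun_on_add:
  assumes "open N" "smooth_fun_on A N f" "smooth_fun_on A N g"
  shows "smooth_fun_on A N (\<lambda>q. f q + g q)"
  using assms unfolding smooth_fun_on_def o_def
  by (fast intro: smooth_on_add chart_image_open)

lemma smooth_fun_on_mult:
  assumes "open N" "smooth_fun_on A N f" "smooth_fun_on A N g"
  shows "smooth_fun_on A N (\<lambda>q. f q * g q)"
  using assms unfolding smooth_fun_on_def o_def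
  by (fast intro: smooth_on_mult chart_image_open)

lemma smooth_fun_on_inverse:
  assumes "open N" "smooth_fun_on A N f" "\<And>q. q \<in> N \<Longrightarrow> f q \<noteq> 0"
  shows "smooth_fun_on A N (\<lambda>q. inverse (f q))"
  unfolding smooth_fun_on_def o_def
proof safe
  fix U \<phi> assume chart: "(U, \<phi>) \<in> A"
  then have "smooth_on (\<phi> ` (U \<inter> N)) (\<lambda>x. f (inv_into U \<phi> x))"
    using assms(2) by (auto simp: smooth_fun_on_def o_def)
  then show "smooth_on (\<phi> ` (U \<inter> N)) (\<lambda>x. inverse (f (inv_into U \<phi> x)))"
    by (rule smooth_on_inverse[OF chart_image_open[OF chart \<open>open N\<close>]])
      (auto simp: chart_inverse[OF chart] assms(3))
qed

lemma smooth_fun_on_sum: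
  "open N \<Longrightarrow> (\<And>i. i \<in> I \<Longrightarrow> smooth_fun_on A N (f i)) \<Longrightarrow> smooth_fun_on A N (\<lambda>q. \<Sum>i\<in>I. f i q)"
  by (induction I rule: infinite_finite_induct) (auto intro: smooth_fun_on_const smooth_fun_on_add)

lemma smooth_fun_on_prod:
  "open N \<Longrightarrow> (\<And>i. i \<in> I \<Longrightarrow> smooth_fun_on A N (f i)) \<Longrightarrow> smooth_fun_on A N (\<lambda>q. \<Prod>i\<in>I. f i q)"
  by (induction I rule: infinite_finite_induct) (auto intro: smooth_fun_on_const smooth_fun_on_mult)

lemma smooth_functions_const: "(\<lambda>_. c) \<in> smooth_functions A"
  by (simp add: smooth_functions_iff smooth_fun_on_const)

lemma smooth_functions_add:
  "f \<in> smooth_functions A \<Longrightarrow> g \<in> smooth_functions A \<Longrightarrow> (\<lambda>q. f q + g q) \<in> smooth_functions A"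
  by (simp add: smooth_functions_iff smooth_fun_on_add)

lemma smooth_functions_mult:
  "f \<in> smooth_functions A \<Longrightarrow> g \<in> smooth_functions A \<Longrightarrow> (\<lambda>q. f q * g q) \<in> smooth_functions A"
  by (simp add: smooth_functions_iff smooth_fun_on_mult)

lemma smooth_functions_diff:
  "f \<in> smooth_functions A \<Longrightarrow> g \<in> smooth_functions A \<Longrightarrow> (\<lambda>q. f q - g q) \<in> smooth_functions A"
  using smooth_functions_add[OF _ smooth_functions_mult[OF smooth_functions_const[of "- 1"]]] by simp

lemma smooth_functions_sum:
  "(\<And>i. i \<in> I \<Longrightarrow> f i \<in> smooth_functions A) \<Longrightarrow> (\<lambda>q. \<Sum>i\<in>I. f i q) \<in> smooth_functions A"
  by (simp add: smooth_functions_iff smooth_fun_on_sum)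

lemma smooth_fun_on_chart:
  assumes "(U, \<phi>) \<in> A" "smooth_fun_on A N f" "N \<subseteq> U"
  shows "smooth_on (\<phi> ` N) (f \<circ> inv_into U \<phi>)"
proof -
  have "U \<inter> N = N" using assms(3) by auto
  then show ?thesis using assms by (force simp: smooth_fun_on_def)
qed

text \<open>Smoothness in the one chart where the function is given must be carried to all others:
  seen from another chart it is \<open>F\<close> composed with a transition map.\<close>

lemma smooth_fun_on_pullback:
  assumes chart: "(U, \<phi>) \<in> A" and "open N" "N \<subseteq> U" "smooth_on (\<phi> ` N) F"
  shows "smooth_fun_on A N (\<lambda>q. F (\<phi> q))"
  unfolding smooth_fun_on_def
proof safe
  fix V \<psi> assume V: "(V, \<psi>) \<in> A"
  have transition: "\<forall>a\<in>A. \<forall>b\<in>A. smooth_on (snd a ` (fst a \<inter> fst b)) (snd b \<circ> inv_into (fst a) (snd a))"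
    using smooth_manifold by (simp add: smooth_manifold_def split_beta)
  have "smooth_on (\<psi> ` (V \<inter> U)) (\<phi> \<circ> inv_into V \<psi>)"
    using bspec[OF bspec[OF transition V] chart] by simp
  then have "smooth_on (\<psi> ` (V \<inter> N)) (\<phi> \<circ> inv_into V \<psi>)"
    by (rule smooth_on_subset) (use \<open>N \<subseteq> U\<close> in auto)
  moreover have "open (\<phi> ` N)"
    using chart_image_open[OF chart \<open>open N\<close>] \<open>N \<subseteq> U\<close> by (simp add: Int_absorb1)
  moreover have "(\<phi> \<circ> inv_into V \<psi>) ` \<psi> ` (V \<inter> N) \<subseteq> \<phi> ` N"
    by (auto simp: chart_inverse[OF V])
  ultimately have "smooth_on (\<psi> ` (V \<inter> N)) (\<lambda>y. F ((\<phi> \<circ> inv_into V \<psi>) y))"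
    using smooth_on_compose[OF chart_image_open[OF V \<open>open N\<close>] _ _ assms(4)] by blast
  then show "smooth_on (\<psi> ` (V \<inter> N)) ((\<lambda>q. F (\<phi> q)) \<circ> inv_into V \<psi>)"
    by (simp add: o_def)
qed

text \<open>The open sets \<open>N\<close> and \<open>- K\<close> cover the manifold; on the first
  the product is smooth, on the second it is constantly 0, whatever \<open>g\<close> does
  there.\<close>

lemma smooth_functions_cutoff:
  assumes "open N" "smooth_fun_on A N g" "\<rho> \<in> smooth_functions A"
    and "closed K" "K \<subseteq> N" "\<And>q. q \<notin> K \<Longrightarrow> \<rho> q = 0"
  shows "(\<lambda>q. \<rho> q * g q) \<in> smooth_functions A"
proof (rule smooth_functionsI)
  fix p
  show "\<exists>M. open M \<and> p \<in> M \<and> smooth_fun_on A M (\<lambda>q. \<rho> q * g q)"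
  proof (cases "p \<in> K")
    case True
    then show ?thesis
      using assms smooth_fun_on_mult[OF \<open>open N\<close> smooth_functions_on[OF assms(3)] assms(2)] by blast
  next
    case False
    have "smooth_fun_on A (- K) (\<lambda>q. \<rho> q * g q)"
      by (rule smooth_fun_on_cong[OF _ smooth_fun_on_const[of _ _ 0]]) (use assms in auto)
    then show ?thesis using False \<open>closed K\<close> by blast
  qed
qed

lemma manifold_bump:
  assumes "open N" "p \<in> N"
  obtains \<rho> M K where "\<rho> \<in> smooth_functions A" "open M" "p \<in> M" "M \<subseteq> K" "closed K" "K \<subseteq> N"
    "\<And>q. q \<in> M \<Longrightarrow> \<rho> q = 1" "\<And>q. q \<notin> K \<Longrightarrow> \<rho> q = 0"
proof -
  obtain U \<phi> where chart: "(U, \<phi>) \<in> A" and "p \<in> U" by (rule chart_at)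
  note U = chart_homeomorphism[OF chart]
  have "\<phi> p \<in> \<phi> ` (U \<inter> N)" using \<open>p \<in> U\<close> \<open>p \<in> N\<close> by simp
  then obtain e where "e > 0" and e: "cball (\<phi> p) e \<subseteq> \<phi> ` (U \<inter> N)"
    using chart_image_open[OF chart \<open>open N\<close>] open_contains_cball by blast
  define r where "r = e / 2"
  have "r > 0" and r: "cball (\<phi> p) (2 * r) \<subseteq> \<phi> ` (U \<inter> N)"
    using e \<open>e > 0\<close> by (auto simp: r_def)
  obtain b :: "real ^ 'n \<Rightarrow> real" where b: "smooth_on UNIV b" "\<And>x. dist (\<phi> p) x \<le> r \<Longrightarrow> b x = 1"
    "\<And>x. dist (\<phi> p) x \<ge> 2 * r \<Longrightarrow> b x = 0"
    using bump_function[OF \<open>r > 0\<close>] by metis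
  define K where "K = inv_into U \<phi> ` cball (\<phi> p) (2 * r)"
  have "continuous_on (cball (\<phi> p) (2 * r)) (inv_into U \<phi>)"
    using homeomorphism_cont2[OF U(3)] by (rule continuous_on_subset) (use r in auto)
  \<comment> \<open>A compact subset of a Hausdorff space is closed. This makes the extension by 0
    smooth, as \<open>U\<close> and \<open>- K\<close> are then an open cover.\<close>
  then have "closed K"
    unfolding K_def by (intro compact_imp_closed compact_continuous_image) auto
  have KN: "K \<subseteq> U \<inter> N"
    unfolding K_def using r chart_inverse[OF chart] by force
  have K_iff: "q \<in> K \<longleftrightarrow> dist (\<phi> p) (\<phi> q) \<le> 2 * r" if "q \<in> U" for q
  proof
    assume "q \<in> K"
    then obtain y where y: "dist (\<phi> p) y \<le> 2 * r" "q = inv_into U \<phi> y" by (auto simp: K_def)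
    then have "y \<in> \<phi> ` U" using r by auto
    then show "dist (\<phi> p) (\<phi> q) \<le> 2 * r" using y by (simp add: f_inv_into_f)
  next
    assume "dist (\<phi> p) (\<phi> q) \<le> 2 * r"
    then show "q \<in> K" unfolding K_def by (intro image_eqI[of _ _ "\<phi> q"]) (auto simp: chart_inverse[OF chart that])
  qed
  \<comment> \<open>The preimage of the ball on which the Euclidean bump equals 1.\<close>
  define M where "M = U \<inter> \<phi> -` ball (\<phi> p) r"
  define \<rho> where "\<rho> q = (if q \<in> U then b (\<phi> q) else 0)" for q
  have \<rho>0: "\<rho> q = 0" if "q \<notin> K" for q
    using that b(3) K_iff[of q] by (auto simp: \<rho>_def)
  show thesis
  proof
    show "open M" unfolding M_def by (rule chart_preimage_open[OF chart]) simp
    show "p \<in> M" using \<open>p \<in> U\<close> \<open>r > 0\<close> by (simp add: M_def)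
    show "M \<subseteq> K" using K_iff \<open>r > 0\<close> by (force simp: M_def)
    show "K \<subseteq> N" using KN by simp
    show "\<rho> q = 1" if "q \<in> M" for q
      using that b(2) by (simp add: M_def \<rho>_def)
    show "\<rho> \<in> smooth_functions A"
    proof (rule smooth_functionsI)
      fix q
      show "\<exists>M. open M \<and> q \<in> M \<and> smooth_fun_on A M \<rho>"
      proof (cases "q \<in> U")
        case True
        have "smooth_fun_on A U (\<lambda>q. b (\<phi> q))"
          using U(1) smooth_on_subset[OF b(1)] by (intro smooth_fun_on_pullback[OF chart]) auto
        then have "smooth_fun_on A U \<rho>"
          by (rule smooth_fun_on_cong[OF U(1)]) (simp add: \<rho>_def)
        then show ?thesis using U(1) True by blast
      next
        case False
        have "smooth_fun_on A (- K) \<rho>"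
          by (rule smooth_fun_on_cong[OF _ smooth_fun_on_const[of _ _ 0]]) (use \<open>closed K\<close> \<rho>0 in auto)
        then show ?thesis using False KN \<open>closed K\<close> by blast
      qed
    qed
  qed (use \<open>closed K\<close> \<rho>0 in auto)
qed


section \<open>Derivations: algebra, locality and coordinate frames\<close>

lemma tangent_space_add:
  "v \<in> tangent_space A p \<Longrightarrow> f \<in> smooth_functions A \<Longrightarrow> g \<in> smooth_functions A \<Longrightarrow>
    v (\<lambda>x. f x + g x) = v f + v g"
  by (simp add: tangent_space_def)

lemma tangent_space_mult:
  "v \<in> tangent_space A p \<Longrightarrow> f \<in> smooth_functions A \<Longrightarrow> g \<in> smooth_functions A \<Longrightarrow>
    v (\<lambda>x. f x * g x) = f p * v g + g p * v f"
  by (simp add: tangent_space_def)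

lemma tangent_space_scale:
  "v \<in> tangent_space A p \<Longrightarrow> f \<in> smooth_functions A \<Longrightarrow> v (\<lambda>x. c * f x) = c * v f"
  by (simp add: tangent_space_def)

lemma tangent_space_nonsmooth: "v \<in> tangent_space A p \<Longrightarrow> f \<notin> smooth_functions A \<Longrightarrow> v f = 0"
  by (simp add: tangent_space_def)

lemma tangent_space_const:
  assumes "v \<in> tangent_space A p"
  shows "v (\<lambda>_. c) = 0"
proof -
  \<comment> \<open>The Leibniz rule for \<open>1 * 1 = 1\<close> gives twice the value on the
    right.\<close>
  have "v (\<lambda>_. 1) = 0"
    using tangent_space_mult[OF assms smooth_functions_const[of 1] smooth_functions_const[of 1]] by simp
  then show ?thesis
    using tangent_space_scale[OF assms smooth_functions_const[of 1], of c] by simp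
qed

lemma tangent_space_diff:
  assumes "v \<in> tangent_space A p" "f \<in> smooth_functions A" "g \<in> smooth_functions A"
  shows "v (\<lambda>x. f x - g x) = v f - v g"
  using tangent_space_add[OF assms(1,2) smooth_functions_mult[OF smooth_functions_const[of "- 1"] assms(3)]]
    tangent_space_scale[OF assms(1,3), of "- 1"]
  by simp

lemma tangent_space_sum:
  assumes "v \<in> tangent_space A p" "\<And>i. i \<in> I \<Longrightarrow> f i \<in> smooth_functions A"
  shows "v (\<lambda>x. \<Sum>i\<in>I. f i x) = (\<Sum>i\<in>I. v (f i))"
  using assms(2)
proof (induction I rule: infinite_finite_induct)
  case (insert i I)
  then show ?case
    using tangent_space_add[OF assms(1) _ smooth_functions_sum[of I f]] by simp
qed (simp_all add: tangent_space_const[OF assms(1)])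

text \<open>For a bump \<open>\<rho>\<close> inside \<open>N\<close> the product of
  \<open>\<rho>\<close> and \<open>f - g\<close> is identically 0. In its Leibniz expansion one term
  vanishes because \<open>f - g\<close> does at \<open>p\<close>, the other is
  \<open>v f - v g\<close>.\<close>

lemma tangent_space_local:
  assumes v: "v \<in> tangent_space A p" and fg: "f \<in> smooth_functions A" "g \<in> smooth_functions A"
    and "open N" "p \<in> N" and eq: "\<And>q. q \<in> N \<Longrightarrow> f q = g q"
  shows "v f = v g"
proof -
  obtain \<rho> M K where \<rho>: "\<rho> \<in> smooth_functions A" "open M" "p \<in> M" "M \<subseteq> K" "closed K" "K \<subseteq> N"
    "\<And>q. q \<in> M \<Longrightarrow> \<rho> q = 1" "\<And>q. q \<notin> K \<Longrightarrow> \<rho> q = 0"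
    using manifold_bump[OF \<open>open N\<close> \<open>p \<in> N\<close>] by metis
  have "(\<lambda>x. \<rho> x * (f x - g x)) = (\<lambda>_. 0)"
    using \<rho>(6,8) eq by fastforce
  then have "v (\<lambda>x. \<rho> x * (f x - g x)) = 0"
    using tangent_space_const[OF v] by simp
  then show ?thesis
    using tangent_space_mult[OF v \<rho>(1) smooth_functions_diff[OF fg]] tangent_space_diff[OF v fg]
      \<rho>(3,7) eq \<open>p \<in> N\<close> by simp
qed

lemma partial_derivative_smooth:
  assumes chart: "(U, \<phi>) \<in> A" and f: "f \<in> smooth_functions A"
  shows "smooth_fun_on A U (\<lambda>q. frechet_derivative (f \<circ> inv_into U \<phi>) (at (\<phi> q)) e)"
  using chart_homeomorphism(1)[OF chart] smooth_functions_on[OF f]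
  by (intro smooth_fun_on_pullback[OF chart] smooth_on_frechet_derivative smooth_fun_on_chart[OF chart]) auto

text \<open>The Leibniz rule of a derivation is the product rule in the chart. The factor
  \<open>c\<close> will be the value of a bump function at \<open>q\<close>.\<close>

lemma partial_derivative_tangent:
  assumes chart: "(U, \<phi>) \<in> A" and "q \<in> U"
  shows "(\<lambda>f. if f \<in> smooth_functions A
      then c * frechet_derivative (f \<circ> inv_into U \<phi>) (at (\<phi> q)) e else 0) \<in> tangent_space A q"
proof -
  have D: "((\<lambda>y. f (inv_into U \<phi> y)) has_derivative
      frechet_derivative (f \<circ> inv_into U \<phi>) (at (\<phi> q))) (at (\<phi> q))" if "f \<in> smooth_functions A" for f
    using smooth_on_derivative[OF smooth_fun_on_chart[OF chart smooth_functions_on[OF that] order_refl]]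
      chart_homeomorphism(2)[OF chart] \<open>q \<in> U\<close> by (simp add: o_def)
  note [simp] = frechet_derivative_at[OF has_derivative_add[OF D D], symmetric]
    frechet_derivative_at[OF has_derivative_mult[OF D D], symmetric]
    frechet_derivative_at[OF has_derivative_mult_right[OF D], symmetric]
  show ?thesis
    using smooth_functions_add smooth_functions_mult smooth_functions_mult[OF smooth_functions_const]
    by (auto simp: tangent_space_def o_def chart_inverse[OF chart \<open>q \<in> U\<close>] algebra_simps)
qed

text \<open>A frame of coordinate vector fields, cut off by a bump function so as to be global. That it
  spans the tangent spaces is Hadamard's lemma, since derivations are local.\<close>

lemma local_frame:
  obtains N and E :: "'n \<Rightarrow> 'a vfield" and x :: "'n \<Rightarrow> 'a \<Rightarrow> real" where "open N" "p \<in> N"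
    "\<And>i. E i \<in> vector_fields A" "\<And>j. x j \<in> smooth_functions A"
    "\<And>q i j. q \<in> N \<Longrightarrow> E i q (x j) = (if i = j then 1 else 0)"
    "\<And>q v. q \<in> N \<Longrightarrow> v \<in> tangent_space A q \<Longrightarrow> v = (\<lambda>f. \<Sum>i\<in>UNIV. v (x i) * E i q f)"
proof -
  obtain U \<phi> where chart: "(U, \<phi>) \<in> A" and "p \<in> U" by (rule chart_at)
  note U = chart_homeomorphism[OF chart]
  obtain \<rho> M K where \<rho>: "\<rho> \<in> smooth_functions A" "open M" "p \<in> M" "M \<subseteq> K" "closed K" "K \<subseteq> U"
    "\<And>q. q \<in> M \<Longrightarrow> \<rho> q = 1" "\<And>q. q \<notin> K \<Longrightarrow> \<rho> q = 0"
    using manifold_bump[OF U(1) \<open>p \<in> U\<close>] by metis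
  have "M \<subseteq> U" using \<rho>(4,6) by simp
  have oM: "open (\<phi> ` M)" using chart_image_open[OF chart \<rho>(2)] \<open>M \<subseteq> U\<close> by (simp add: Int_absorb1)
  define \<delta> where "\<delta> i f q = frechet_derivative (f \<circ> inv_into U \<phi>) (at (\<phi> q)) (axis i 1)"
    for i q and f :: "'a \<Rightarrow> real"
  define E where "E i q f = (if f \<in> smooth_functions A then \<rho> q * \<delta> i f q else 0)" for i q f
  define x where "x j q = \<rho> q * \<phi> q $ j" for j q
  have x: "x j \<in> smooth_functions A" for j
    unfolding x_def
    by (rule smooth_functions_cutoff[OF U(1) smooth_fun_on_pullback[OF chart U(1) order_refl] \<rho>(1,5,6,8)])
      (intro smooth_on_linear U(2) bounded_linear_vec_nth)
  have tangent: "E i q \<in> tangent_space A q" for i q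
  proof (cases "q \<in> U")
    case True
    show ?thesis
      unfolding E_def \<delta>_def by (rule partial_derivative_tangent[OF chart True])
  next
    case False
    then have "\<rho> q = 0" using \<rho>(6,8) by auto
    then show ?thesis by (simp add: E_def tangent_space_def)
  qed
  have E: "E i \<in> vector_fields A" for i
  proof -
    have "(\<lambda>q. \<rho> q * \<delta> i f q) \<in> smooth_functions A" if "f \<in> smooth_functions A" for f
      unfolding \<delta>_def
      by (rule smooth_functions_cutoff[OF U(1) partial_derivative_smooth[OF chart that] \<rho>(1,5,6,8)])
    then show ?thesis
      using tangent by (simp add: vector_fields_def E_def)
  qed
  have dual: "E i q (x j) = (if i = j then 1 else 0)" if "q \<in> M" for i j q
  proof -
    \<comment> \<open>On \<open>M\<close> the bump is 1, so near the point \<open>x j\<close> is the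
      genuine coordinate in the chart and has its derivative.\<close>
    have "((\<lambda>y. y $ j) has_derivative (\<lambda>v. v $ j)) (at (\<phi> q))"
      by (rule bounded_linear.has_derivative[OF bounded_linear_vec_nth has_derivative_ident])
    then have "(x j \<circ> inv_into U \<phi> has_derivative (\<lambda>v. v $ j)) (at (\<phi> q))"
    proof (rule has_derivative_transform_within_open[OF _ oM])
      show "\<phi> q \<in> \<phi> ` M" using that by simp
      show "y $ j = (x j \<circ> inv_into U \<phi>) y" if "y \<in> \<phi> ` M" for y
        using that \<open>M \<subseteq> U\<close> \<rho>(7) by (auto simp: x_def chart_inverse[OF chart] subset_iff)
    qed
    from frechet_derivative_at[OF this] have "\<delta> i (x j) q = axis i 1 $ j"
      by (metis \<delta>_def)
    then show ?thesis
      using x that \<rho>(7) by (auto simp: E_def axis_def)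
  qed
  have span: "v = (\<lambda>f. \<Sum>i\<in>UNIV. v (x i) * E i q f)" if "q \<in> M" and v: "v \<in> tangent_space A q" for q v
  proof
    fix f
    show "v f = (\<Sum>i\<in>UNIV. v (x i) * E i q f)"
    proof (cases "f \<in> smooth_functions A")
      case False
      then show ?thesis by (simp add: E_def tangent_space_nonsmooth[OF v])
    next
      case True
      have "q \<in> U" using \<open>M \<subseteq> U\<close> \<open>q \<in> M\<close> by auto
      \<comment> \<open>Hadamard's lemma needs a convex domain, hence a ball inside the chart image
        of \<open>M\<close>.\<close>
      obtain r where "r > 0" and r: "ball (\<phi> q) r \<subseteq> \<phi> ` M"
        using oM \<open>q \<in> M\<close> open_contains_ball by blast
      have "smooth_on (ball (\<phi> q) r) (f \<circ> inv_into U \<phi>)"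
        by (rule smooth_on_subset[OF smooth_fun_on_chart[OF chart smooth_functions_on[OF True] \<open>M \<subseteq> U\<close>] r])
      from Hadamard[OF open_ball convex_ball _ this, of "\<phi> q"] \<open>r > 0\<close>
      obtain g where g: "\<And>e. smooth_on (ball (\<phi> q) r) (g e)"
        "\<And>e. g e (\<phi> q) = frechet_derivative (f \<circ> inv_into U \<phi>) (at (\<phi> q)) e"
        "\<And>y. y \<in> ball (\<phi> q) r \<Longrightarrow> (f \<circ> inv_into U \<phi>) y =
          (f \<circ> inv_into U \<phi>) (\<phi> q) + (\<Sum>e\<in>Basis. ((y - \<phi> q) \<bullet> e) * g e y)"
        by auto
      define W where "W = U \<inter> \<phi> -` ball (\<phi> q) r"
      have W: "open W" "q \<in> W" "W \<subseteq> U"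
        using chart_preimage_open[OF chart open_ball] \<open>q \<in> U\<close> \<open>r > 0\<close> by (auto simp: W_def)
      have \<phi>W: "\<phi> ` W = ball (\<phi> q) r"
        unfolding W_def by (rule chart_image_preimage[OF chart]) (use r \<open>M \<subseteq> U\<close> in auto)
      \<comment> \<open>Needed so that \<open>\<rho>\<close> is 1 on \<open>W\<close> and the
        cut-off coordinates in the Hadamard expansion are the true ones.\<close>
      have "W \<subseteq> M"
      proof
        fix q' assume "q' \<in> W"
        then have "q' \<in> U" "\<phi> q' \<in> \<phi> ` (U \<inter> M)"
          using r \<open>M \<subseteq> U\<close> by (auto simp: W_def Int_absorb1 subset_iff)
        then show "q' \<in> M" by (rule chart_image_mem[OF chart])
      qed
      obtain \<eta> M' K' where \<eta>: "\<eta> \<in> smooth_functions A" "open M'" "q \<in> M'" "M' \<subseteq> K'" "closed K'" "K' \<subseteq> W"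
        "\<And>q. q \<in> M' \<Longrightarrow> \<eta> q = 1" "\<And>q. q \<notin> K' \<Longrightarrow> \<eta> q = 0"
        using manifold_bump[OF W(1,2)] by metis
      \<comment> \<open>The Hadamard coefficients live on \<open>W\<close> only; a second bump makes
        them global, so that \<open>v\<close> may act on them.\<close>
      define G where "G i q' = \<eta> q' * g (axis i 1) (\<phi> q')" for i q'
      have G: "G i \<in> smooth_functions A" for i
        unfolding G_def
        by (rule smooth_functions_cutoff[OF W(1) smooth_fun_on_pullback[OF chart W(1,3)] \<eta>(1,5,6,8)])
          (simp add: \<phi>W g(1))
      have xq: "x i q = \<phi> q $ i" for i
        using \<rho>(7)[OF \<open>q \<in> M\<close>] by (simp add: x_def)
      have Gq: "G i q = \<delta> i f q" for i
        using g(2) \<eta>(3,7) by (simp add: G_def \<delta>_def)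
      have xG: "(\<lambda>q'. (x i q' - \<phi> q $ i) * G i q') \<in> smooth_functions A" for i
        by (intro smooth_functions_mult smooth_functions_diff smooth_functions_const x G)
      have "v f = v (\<lambda>q'. f q + (\<Sum>i\<in>UNIV. (x i q' - \<phi> q $ i) * G i q'))"
      proof (rule tangent_space_local[OF v True _ \<eta>(2,3)])
        show "(\<lambda>q'. f q + (\<Sum>i\<in>UNIV. (x i q' - \<phi> q $ i) * G i q')) \<in> smooth_functions A"
          by (intro smooth_functions_add smooth_functions_const smooth_functions_sum xG)
        fix q' assume "q' \<in> M'"
        then have "q' \<in> W" "q' \<in> M" "\<eta> q' = 1"
          using \<eta>(4,6,7) \<open>W \<subseteq> M\<close> by auto
        moreover from this have "q' \<in> U" "\<rho> q' = 1"
          using \<open>M \<subseteq> U\<close> \<rho>(7) by auto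
        ultimately show "f q' = f q + (\<Sum>i\<in>UNIV. (x i q' - \<phi> q $ i) * G i q')"
          using g(3)[of "\<phi> q'"] \<open>q \<in> U\<close>
          by (simp add: W_def sum_Basis_axis chart_inverse[OF chart] x_def G_def inner_axis)
      qed
      also have "\<dots> = v (\<lambda>q'. \<Sum>i\<in>UNIV. (x i q' - \<phi> q $ i) * G i q')"
        using tangent_space_add[OF v smooth_functions_const smooth_functions_sum[OF xG]]
          tangent_space_const[OF v] by simp
      also have "\<dots> = (\<Sum>i\<in>UNIV. v (\<lambda>q'. (x i q' - \<phi> q $ i) * G i q'))"
        by (rule tangent_space_sum[OF v xG])
      also have "\<dots> = (\<Sum>i\<in>UNIV. v (x i) * E i q f)"
      \<comment> \<open>The first factor vanishes at \<open>q\<close> and \<open>v\<close> kills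
        constants, so only \<open>v (x i)\<close> times the value of \<open>G i\<close> at
        \<open>q\<close>, the partial derivative of \<open>f\<close>, survives.\<close>
      proof (rule sum.cong[OF refl])
        fix i
        show "v (\<lambda>q'. (x i q' - \<phi> q $ i) * G i q') = v (x i) * E i q f"
          using tangent_space_mult[OF v smooth_functions_diff[OF x smooth_functions_const] G, of i "\<phi> q $ i" i]
            tangent_space_diff[OF v x smooth_functions_const, of i "\<phi> q $ i"]
          by (simp add: xq Gq tangent_space_const[OF v] E_def True \<rho>(7)[OF \<open>q \<in> M\<close>])
      qed
      finally show ?thesis .
    qed
  qed
  show thesis
    using that[OF \<rho>(2,3) E x dual span] .
qed

end


section \<open>Tensorial constructions\<close>

text \<open>A covector without the convention of being 0 off the tangent space. Partial evaluations
  of a tensor field are linear in this sense but need not obey that convention.\<close>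

definition tangent_linear :: "('a, 'n::finite) atlas \<Rightarrow> 'a \<Rightarrow> 'a covec \<Rightarrow> bool" where
  "tangent_linear A p a \<longleftrightarrow>
     (\<forall>v \<in> tangent_space A p. \<forall>w \<in> tangent_space A p. a (\<lambda>f. v f + w f) = a v + a w) \<and>
     (\<forall>v \<in> tangent_space A p. \<forall>c. a (\<lambda>f. c * v f) = c * a v)"

lemma cotangent_linear: "a \<in> cotangent_space A p \<Longrightarrow> tangent_linear A p a"
  by (simp add: cotangent_space_def tangent_linear_def)

lemma tensor_linear:
  assumes "h \<in> tensor_fields2 A" "w \<in> tangent_space A p"
  shows "tangent_linear A p (\<lambda>v. h p v w)" "tangent_linear A p (h p w)"
  using assms by (simp_all add: tensor_fields2_def tangent_linear_def)

lemma vector_fields_tangent: "X \<in> vector_fields A \<Longrightarrow> X p \<in> tangent_space A p"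
  by (simp add: vector_fields_def)

lemma vector_fields_smooth:
  "X \<in> vector_fields A \<Longrightarrow> f \<in> smooth_functions A \<Longrightarrow> (\<lambda>p. X p f) \<in> smooth_functions A"
  by (simp add: vector_fields_def)

lemma one_forms_cotangent: "\<alpha> \<in> one_forms A \<Longrightarrow> \<alpha> p \<in> cotangent_space A p"
  by (simp add: one_forms_def)

lemma one_forms_linear: "\<alpha> \<in> one_forms A \<Longrightarrow> tangent_linear A p (\<alpha> p)"
  by (simp add: one_forms_cotangent cotangent_linear)

lemma one_forms_smooth:
  "\<alpha> \<in> one_forms A \<Longrightarrow> X \<in> vector_fields A \<Longrightarrow> (\<lambda>p. \<alpha> p (X p)) \<in> smooth_functions A"
  by (simp add: one_forms_def)

lemma tensor_fields2_smooth:
  "h \<in> tensor_fields2 A \<Longrightarrow> X \<in> vector_fields A \<Longrightarrow> Y \<in> vector_fields A \<Longrightarrow>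
    (\<lambda>p. h p (X p) (Y p)) \<in> smooth_functions A"
  by (simp add: tensor_fields2_def)

lemma flat_apply: "w \<in> tangent_space A p \<Longrightarrow> flat A h X p w = h p (X p) w"
  by (simp add: flat_def)

context smooth_atlas
begin

text \<open>The determinant is a polynomial in the entries.\<close>

lemma smooth_fun_on_det:
  fixes B :: "'a \<Rightarrow> real ^ 'm ^ 'm"
  assumes "open N" "\<And>i j. smooth_fun_on A N (\<lambda>q. B q $ i $ j)"
  shows "smooth_fun_on A N (\<lambda>q. det (B q))"
  unfolding det_def
  by (intro smooth_fun_on_sum smooth_fun_on_mult smooth_fun_on_const smooth_fun_on_prod assms)

section \<open>Linear algebra of tangent vectors and vector fields\<close>

lemma tangent_space_plus:
  "v \<in> tangent_space A p \<Longrightarrow> w \<in> tangent_space A p \<Longrightarrow> (\<lambda>f. v f + w f) \<in> tangent_space A p"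
  by (auto simp: tangent_space_def algebra_simps)

lemma tangent_space_smult: "v \<in> tangent_space A p \<Longrightarrow> (\<lambda>f. c * v f) \<in> tangent_space A p"
  by (auto simp: tangent_space_def algebra_simps)

lemma tangent_space_zero: "(\<lambda>f. 0) \<in> tangent_space A p"
  by (simp add: tangent_space_def)

lemma tangent_space_lincomb:
  "(\<And>i. i \<in> I \<Longrightarrow> v i \<in> tangent_space A p) \<Longrightarrow> (\<lambda>f. \<Sum>i\<in>I. c i * v i f) \<in> tangent_space A p"
proof (induction I rule: infinite_finite_induct)
  case (insert i I)
  then show ?case
    using tangent_space_plus[OF tangent_space_smult[of "v i" p "c i"]] by simp
qed (simp_all add: tangent_space_zero)

lemma tangent_linear_zero: "tangent_linear A p a \<Longrightarrow> a (\<lambda>f. 0) = 0"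
  using tangent_space_zero[of p] by (force simp: tangent_linear_def dest: bspec[of _ _ "\<lambda>f. 0"] spec[of _ 0])

lemma tangent_linear_lincomb:
  assumes "tangent_linear A p a" "\<And>i. i \<in> I \<Longrightarrow> v i \<in> tangent_space A p"
  shows "a (\<lambda>f. \<Sum>i\<in>I. c i * v i f) = (\<Sum>i\<in>I. c i * a (v i))"
  using assms(2)
proof (induction I rule: infinite_finite_induct)
  case (insert i I)
  then show ?case
    using assms(1) tangent_space_smult[of "v i" p "c i"] tangent_space_lincomb[of I v p c]
    by (simp add: tangent_linear_def)
qed (simp_all add: tangent_linear_zero[OF assms(1)])

lemma vector_fields_add:
  "X \<in> vector_fields A \<Longrightarrow> Y \<in> vector_fields A \<Longrightarrow> sec_add X Y \<in> vector_fields A"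
  by (simp add: vector_fields_def sec_add_def tangent_space_plus smooth_functions_add)

lemma vector_fields_scale:
  "u \<in> smooth_functions A \<Longrightarrow> X \<in> vector_fields A \<Longrightarrow> sec_scale u X \<in> vector_fields A"
  by (simp add: vector_fields_def sec_scale_def tangent_space_smult smooth_functions_mult)

lemma vector_fields_zero: "(\<lambda>p f. 0) \<in> vector_fields A"
  by (simp add: vector_fields_def tangent_space_zero smooth_functions_const)

lemma vector_fields_lincomb:
  "(\<And>i. i \<in> I \<Longrightarrow> u i \<in> smooth_functions A) \<Longrightarrow> (\<And>i. i \<in> I \<Longrightarrow> E i \<in> vector_fields A) \<Longrightarrow>
    (\<lambda>p f. \<Sum>i\<in>I. u i p * E i p f) \<in> vector_fields A"
  by (auto simp: vector_fields_def tangent_space_lincomb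
      intro!: smooth_functions_sum smooth_functions_mult)

text \<open>The frame fields are global, so the coordinates of \<open>v\<close> at \<open>p\<close>
  can be used as constant coefficients everywhere.\<close>

lemma tangent_vector_extends:
  assumes "v \<in> tangent_space A p"
  obtains X where "X \<in> vector_fields A" "X p = v"
proof -
  obtain N E x where "p \<in> N" and E: "\<And>i. E i \<in> vector_fields A"
    and "\<And>q v. q \<in> N \<Longrightarrow> v \<in> tangent_space A q \<Longrightarrow> v = (\<lambda>f. \<Sum>i\<in>(UNIV::'n set). v (x i) * E i q f)"
    by (rule local_frame) blast
  then show thesis
    using that[OF vector_fields_lincomb[of UNIV "\<lambda>i _. v (x i)" E]] assms smooth_functions_const by simp
qed

text \<open>Fields reach every tangent vector, and off the tangent space both forms are 0 by
  convention; together this yields equality as HOL functions.\<close>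

lemma one_form_eqI:
  assumes "\<theta> \<in> one_forms A" "\<theta>' \<in> one_forms A"
    and "\<And>Y p. Y \<in> vector_fields A \<Longrightarrow> \<theta> p (Y p) = \<theta>' p (Y p)"
  shows "\<theta> = \<theta>'"
proof (intro ext)
  fix p w
  show "\<theta> p w = \<theta>' p w"
  proof (cases "w \<in> tangent_space A p")
    case True
    then obtain Y where "Y \<in> vector_fields A" "Y p = w" by (rule tangent_vector_extends)
    then show ?thesis using assms(3) by blast
  next
    case False
    then show ?thesis
      using one_forms_cotangent[OF assms(1)] one_forms_cotangent[OF assms(2)]
      by (simp add: cotangent_space_def)
  qed
qed

text \<open>A functional on vector fields that is linear over the smooth functions is a 1-form: multiplying
  by a bump function expresses its value at a point through the values on a local frame.\<close>

lemma tensorial_functional_one_form: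
  fixes \<omega> :: "'a vfield \<Rightarrow> 'a \<Rightarrow> real"
  assumes smooth: "\<And>Y. Y \<in> vector_fields A \<Longrightarrow> \<omega> Y \<in> smooth_functions A"
    and add: "\<And>Y Z p. Y \<in> vector_fields A \<Longrightarrow> Z \<in> vector_fields A \<Longrightarrow> \<omega> (sec_add Y Z) p = \<omega> Y p + \<omega> Z p"
    and scale: "\<And>u Y p. u \<in> smooth_functions A \<Longrightarrow> Y \<in> vector_fields A \<Longrightarrow>
      \<omega> (sec_scale u Y) p = u p * \<omega> Y p"
  shows "\<exists>!\<theta>. \<theta> \<in> one_forms A \<and> (\<forall>Y \<in> vector_fields A. \<forall>p. \<theta> p (Y p) = \<omega> Y p)"
proof -
  have zero: "\<omega> (\<lambda>q f. 0) p = 0" for p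
    using scale[OF smooth_functions_const[of 0] vector_fields_zero, of p] by (simp add: sec_scale_def)
  have lincomb: "\<omega> (\<lambda>q f. \<Sum>i\<in>I. u i q * E i q f) p = (\<Sum>i\<in>I. u i p * \<omega> (E i) p)"
    if "\<And>i. i \<in> I \<Longrightarrow> u i \<in> smooth_functions A" "\<And>i. i \<in> I \<Longrightarrow> E i \<in> vector_fields A"
    for u and E :: "'n \<Rightarrow> 'a vfield" and I p
    using finite[of I] that
  proof (induction I)
    case (insert i I)
    have "\<omega> (sec_add (sec_scale (u i) (E i)) (\<lambda>q f. \<Sum>i\<in>I. u i q * E i q f)) p =
        u i p * \<omega> (E i) p + (\<Sum>i\<in>I. u i p * \<omega> (E i) p)"
      using insert by (simp add: add scale vector_fields_scale vector_fields_lincomb)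
    then show ?case
      using insert by (simp add: sec_add_def sec_scale_def)
  qed (simp add: zero)
  have pointwise: "\<omega> Y p = \<omega> Y' p" if Y: "Y \<in> vector_fields A" "Y' \<in> vector_fields A" "Y p = Y' p" for Y Y' p
  proof -
    obtain N and E :: "'n \<Rightarrow> 'a vfield" and x where "open N" "p \<in> N" and E: "\<And>i. E i \<in> vector_fields A"
      and x: "\<And>i. x i \<in> smooth_functions A"
      and span: "\<And>q v. q \<in> N \<Longrightarrow> v \<in> tangent_space A q \<Longrightarrow> v = (\<lambda>f. \<Sum>i\<in>UNIV. v (x i) * E i q f)"
      by (rule local_frame) blast
    obtain \<rho> M K where \<rho>: "\<rho> \<in> smooth_functions A" "p \<in> M" "K \<subseteq> N"
      "\<And>q. q \<in> M \<Longrightarrow> \<rho> q = 1" "\<And>q. q \<notin> K \<Longrightarrow> \<rho> q = 0"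
      using manifold_bump[OF \<open>open N\<close> \<open>p \<in> N\<close>] by metis
    have "\<omega> Y p = (\<Sum>i\<in>UNIV. Y p (x i) * \<omega> (E i) p)" if Y: "Y \<in> vector_fields A" for Y
    proof -
      \<comment> \<open>The frame expansion is valid on \<open>N\<close> only; after multiplication
        by \<open>\<rho>\<close>, which is 0 off \<open>N\<close>, it becomes an identity of global
        fields to which linearity of \<open>\<omega>\<close> applies.\<close>
      have "sec_scale \<rho> Y = (\<lambda>q f. \<Sum>i\<in>UNIV. (\<rho> q * Y q (x i)) * E i q f)"
      proof (intro ext)
        fix q f
        show "sec_scale \<rho> Y q f = (\<Sum>i\<in>UNIV. (\<rho> q * Y q (x i)) * E i q f)"
        proof (cases "q \<in> N")
          case True
          from fun_cong[OF span[OF this vector_fields_tangent[OF Y]], of f]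
          show ?thesis by (simp add: sec_scale_def sum_distrib_left mult.assoc)
        next
          case False
          then have "\<rho> q = 0" using \<rho>(3,5) by blast
          then show ?thesis by (simp add: sec_scale_def)
        qed
      qed
      then have "\<rho> p * \<omega> Y p = (\<Sum>i\<in>UNIV. (\<rho> p * Y p (x i)) * \<omega> (E i) p)"
        using lincomb[of UNIV "\<lambda>i q. \<rho> q * Y q (x i)" E p] scale[OF \<rho>(1) Y, of p] E
          smooth_functions_mult[OF \<rho>(1) vector_fields_smooth[OF Y x]] by simp
      then show ?thesis using \<rho>(2,4) by simp
    qed
    then show ?thesis using Y by simp
  qed
  \<comment> \<open>Any extension of \<open>w\<close> to a field will do, since by
    \<open>pointwise\<close> the value at \<open>p\<close> depends on the vector at \<open>p\<close>
    alone. The 0 is the convention for covectors.\<close>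
  define \<theta> where "\<theta> p w = (if w \<in> tangent_space A p
    then \<omega> (SOME Y. Y \<in> vector_fields A \<and> Y p = w) p else 0)" for p w
  have \<theta>: "\<theta> p (Y p) = \<omega> Y p" if Y: "Y \<in> vector_fields A" for Y p
  proof -
    define Y' where "Y' = (SOME Y'. Y' \<in> vector_fields A \<and> Y' p = Y p)"
    have "Y' \<in> vector_fields A \<and> Y' p = Y p"
      unfolding Y'_def by (rule someI[of _ Y]) (simp add: Y)
    then show ?thesis
      using pointwise[of Y' Y p] Y by (simp add: \<theta>_def vector_fields_tangent Y'_def)
  qed
  have "\<theta> p \<in> cotangent_space A p" for p
  proof -
    have "\<theta> p (\<lambda>f. v f + w f) = \<theta> p v + \<theta> p w"
      if v: "v \<in> tangent_space A p" and w: "w \<in> tangent_space A p" for v w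
    proof -
      obtain X where "X \<in> vector_fields A" "X p = v" by (rule tangent_vector_extends[OF v])
      moreover obtain Y where "Y \<in> vector_fields A" "Y p = w" by (rule tangent_vector_extends[OF w])
      ultimately show ?thesis
        using add[of X Y p] \<theta>[of "sec_add X Y" p] \<theta>[of X p] \<theta>[of Y p] vector_fields_add[of X Y]
        by (simp add: sec_add_def)
    qed
    moreover have "\<theta> p (\<lambda>f. c * v f) = c * \<theta> p v" if v: "v \<in> tangent_space A p" for v c
    proof -
      obtain X where "X \<in> vector_fields A" "X p = v" by (rule tangent_vector_extends[OF v])
      then show ?thesis
        using scale[OF smooth_functions_const, of X c p] \<theta>[of "sec_scale (\<lambda>_. c) X" p] \<theta>[of X p]
          vector_fields_scale[OF smooth_functions_const, of X c]
        by (simp add: sec_scale_def)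
    qed
    ultimately show ?thesis by (simp add: cotangent_space_def \<theta>_def)
  qed
  then have "\<theta> \<in> one_forms A"
    using smooth by (simp add: one_forms_def \<theta>)
  then show ?thesis
    using \<theta> by (intro ex1I[of _ \<theta>]) (auto intro: one_form_eqI)
qed

text \<open>Tensoriality of the defining expression, together with the uniqueness of a 1-form with
  given values on fields, makes the description in \<open>cov_form\<close> denote.\<close>

lemma cov_form:
  assumes D: "affine_connection A D" and X: "X \<in> vector_fields A" and \<beta>: "\<beta> \<in> one_forms A"
  shows "cov_form A D X \<beta> \<in> one_forms A"
    and "Y \<in> vector_fields A \<Longrightarrow>
      cov_form A D X \<beta> p (Y p) = X p (\<lambda>q. \<beta> q (Y q)) - \<beta> p (D X Y p)"
proof -
  define \<omega> where "\<omega> Y p = X p (\<lambda>q. \<beta> q (Y q)) - \<beta> p (D X Y p)" for Y p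
  have DX: "D X Y \<in> vector_fields A" if "Y \<in> vector_fields A" for Y
    using D X that by (simp add: affine_connection_def)
  note lin = one_forms_linear[OF \<beta>, unfolded tangent_linear_def]
  have \<beta>_add: "\<beta> p (sec_add Y Z p) = \<beta> p (Y p) + \<beta> p (Z p)"
    if "Y \<in> vector_fields A" "Z \<in> vector_fields A" for Y Z p
    using lin that by (simp add: sec_add_def vector_fields_tangent)
  have \<beta>_scale: "\<beta> p (sec_scale u Y p) = u p * \<beta> p (Y p)" if "Y \<in> vector_fields A" for u Y p
    using lin that by (simp add: sec_scale_def vector_fields_tangent)
  note Xp = vector_fields_tangent[OF X]
  have "\<exists>!\<theta>. \<theta> \<in> one_forms A \<and> (\<forall>Y \<in> vector_fields A. \<forall>p. \<theta> p (Y p) = \<omega> Y p)"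
  proof (rule tensorial_functional_one_form)
    fix Y Z p assume Y: "Y \<in> vector_fields A"
    show "\<omega> Y \<in> smooth_functions A"
      unfolding \<omega>_def
      using smooth_functions_diff[OF vector_fields_smooth[OF X one_forms_smooth[OF \<beta> Y]]
          one_forms_smooth[OF \<beta> DX[OF Y]]] .
    show "\<omega> (sec_scale u Y) p = u p * \<omega> Y p" if u: "u \<in> smooth_functions A" for u
    proof -
      have "D X (sec_scale u Y) = sec_add (sec_scale (\<lambda>p. X p u) Y) (sec_scale u (D X Y))"
        using D X Y u by (simp add: affine_connection_def)
      then have "\<beta> p (D X (sec_scale u Y) p) = X p u * \<beta> p (Y p) + u p * \<beta> p (D X Y p)"
        using Y DX[OF Y] u X by (simp add: \<beta>_add \<beta>_scale vector_fields_scale vector_fields_smooth)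
      \<comment> \<open>The derivative of \<open>u\<close> arises twice, from the Leibniz rule of
        the vector at \<open>p\<close> and from that of the connection, and cancels.\<close>
      then show ?thesis
        using tangent_space_mult[OF Xp u one_forms_smooth[OF \<beta> Y]]
        by (simp add: \<omega>_def \<beta>_scale[OF Y] algebra_simps)
    qed
    assume Z: "Z \<in> vector_fields A"
    have "D X (sec_add Y Z) = sec_add (D X Y) (D X Z)"
      using D X Y Z by (simp add: affine_connection_def)
    then show "\<omega> (sec_add Y Z) p = \<omega> Y p + \<omega> Z p"
      using tangent_space_add[OF Xp one_forms_smooth[OF \<beta> Y] one_forms_smooth[OF \<beta> Z]]
      by (simp add: \<omega>_def \<beta>_add Y Z DX)
  qed
  from theI'[OF this] show "cov_form A D X \<beta> \<in> one_forms A"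
    and "Y \<in> vector_fields A \<Longrightarrow>
      cov_form A D X \<beta> p (Y p) = X p (\<lambda>q. \<beta> q (Y q)) - \<beta> p (D X Y p)"
    by (simp_all add: cov_form_def \<omega>_def)
qed

end


section \<open>The musical isomorphisms\<close>

locale nondegenerate_tensor = smooth_atlas A
  for A :: "('a::{t2_space, second_countable_topology}, 'n::finite) atlas" +
  fixes h :: "'a tensor2"
  assumes tensor: "h \<in> tensor_fields2 A" and nondegenerate: "nondegenerate A h"
begin

text \<open>Non-degeneracy applied to the difference, written with a factor \<open>- 1\<close> to
  fit the linearity rules.\<close>

lemma tensor_cancel:
  assumes v: "v \<in> tangent_space A p" "v' \<in> tangent_space A p"
    and eq: "\<And>w. w \<in> tangent_space A p \<Longrightarrow> h p v w = h p v' w"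
  shows "v = v'"
proof -
  let ?d = "\<lambda>f. v f + - 1 * v' f"
  have d: "?d \<in> tangent_space A p"
    by (intro tangent_space_plus tangent_space_smult v)
  have "h p ?d w = 0" if w: "w \<in> tangent_space A p" for w
  proof -
    have "h p ?d w = h p v w + - 1 * h p v' w"
      using tensor_linear(1)[OF tensor w] v tangent_space_smult[OF v(2), of "- 1"]
      by (simp only: tangent_linear_def)
    then show ?thesis using eq[OF w] by simp
  qed
  then have "?d = (\<lambda>f. 0)"
    using nondegenerate d by (simp add: nondegenerate_def)
  then show ?thesis by (simp add: fun_eq_iff)
qed

text \<open>A kernel vector \<open>z\<close> of the Gram matrix yields a tangent vector that pairs
  to 0 with the frame, hence with everything. The indices are arranged so that
  \<open>H q *v z\<close> lists the pairings of that combination in the first slot with the frame;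
  no symmetry of \<open>h\<close> is available here.\<close>

lemma gram_frame:
  obtains N E x and H :: "'a \<Rightarrow> real ^ 'n ^ 'n" where "open N" "p \<in> N"
    "\<And>i. E i \<in> vector_fields A"
    "\<And>q v. q \<in> N \<Longrightarrow> v \<in> tangent_space A q \<Longrightarrow> v = (\<lambda>f. \<Sum>i\<in>UNIV. v (x i) * E i q f)"
    "\<And>q. H q = (\<chi> j i. h q (E i q) (E j q))" "\<And>q. q \<in> N \<Longrightarrow> det (H q) \<noteq> 0"
proof -
  obtain N and E :: "'n \<Rightarrow> 'a vfield" and x where N: "open N" "p \<in> N" and E: "\<And>i. E i \<in> vector_fields A"
    and dual: "\<And>q i j. q \<in> N \<Longrightarrow> E i q (x j) = (if i = j then 1 else 0)"
    and span: "\<And>q v. q \<in> N \<Longrightarrow> v \<in> tangent_space A q \<Longrightarrow> v = (\<lambda>f. \<Sum>i\<in>UNIV. v (x i) * E i q f)"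
    by (rule local_frame) blast
  define H where "H q = ((\<chi> j i. h q (E i q) (E j q)) :: real ^ 'n ^ 'n)" for q
  have "det (H q) \<noteq> 0" if q: "q \<in> N" for q
  proof -
    have Eq: "E i q \<in> tangent_space A q" for i using vector_fields_tangent[OF E] .
    have "z = 0" if z: "H q *v z = 0" for z
    proof -
      define v where "v f = (\<Sum>i\<in>UNIV. z $ i * E i q f)" for f
      have v: "v \<in> tangent_space A q"
        unfolding v_def by (rule tangent_space_lincomb) (rule Eq)
      have vE: "h q v (E j q) = 0" for j
      proof -
        have "h q v (E j q) = (\<Sum>i\<in>UNIV. z $ i * h q (E i q) (E j q))"
          unfolding v_def by (rule tangent_linear_lincomb[OF tensor_linear(1)[OF tensor Eq]]) (rule Eq)
        also have "\<dots> = (H q *v z) $ j"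
          by (simp add: H_def matrix_vector_mult_def mult.commute)
        finally show ?thesis using z by simp
      qed
      have "h q v w = 0" if w: "w \<in> tangent_space A q" for w
      proof -
        have "h q v w = h q v (\<lambda>f. \<Sum>i\<in>UNIV. w (x i) * E i q f)"
          using span[OF q w] by simp
        also have "\<dots> = (\<Sum>i\<in>UNIV. w (x i) * h q v (E i q))"
          by (rule tangent_linear_lincomb[OF tensor_linear(2)[OF tensor v]]) (rule Eq)
        finally show ?thesis by (simp add: vE)
      qed
      then have "v = (\<lambda>f. 0)"
        using nondegenerate v by (simp add: nondegenerate_def)
      \<comment> \<open>Evaluation at the coordinate \<open>x j\<close> recovers
        \<open>z $ j\<close>, as the frame is dual to the coordinates.\<close>
      then have "(\<Sum>i\<in>UNIV. z $ i * E i q (x j)) = 0" for j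
        by (simp add: v_def fun_eq_iff)
      then show "z = 0"
        by (simp add: dual[OF q] vec_eq_iff if_distrib cong: if_cong)
    qed
    then show ?thesis
      by (simp add: invertible_det_nz[symmetric] invertible_left_inverse matrix_left_invertible_ker)
  qed
  then show thesis
    using that[OF N E span H_def] by blast
qed

text \<open>Solving the Gram system matches \<open>a\<close> on the frame; linearity in
  \<open>w\<close> extends the match to all tangent vectors, and \<open>tensor_cancel\<close> gives
  uniqueness.\<close>

lemma sharp_ex1:
  assumes a: "a \<in> cotangent_space A p"
  shows "\<exists>!v. v \<in> tangent_space A p \<and> (\<forall>w \<in> tangent_space A p. h p v w = a w)"
proof -
  obtain N E x and H :: "'a \<Rightarrow> real ^ 'n ^ 'n" where p: "p \<in> N" and E: "\<And>i. E i \<in> vector_fields A"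
    and span: "\<And>q v. q \<in> N \<Longrightarrow> v \<in> tangent_space A q \<Longrightarrow> v = (\<lambda>f. \<Sum>i\<in>UNIV. v (x i) * E i q f)"
    and H: "\<And>q. H q = (\<chi> j i. h q (E i q) (E j q))" and det: "\<And>q. q \<in> N \<Longrightarrow> det (H q) \<noteq> 0"
    by (rule gram_frame) blast
  have Ep: "E i p \<in> tangent_space A p" for i using vector_fields_tangent[OF E] .
  obtain z where z: "H p *v z = (\<chi> j. a (E j p))"
    using cramer[OF det[OF p]] by blast
  define v where "v f = (\<Sum>i\<in>UNIV. z $ i * E i p f)" for f
  have v: "v \<in> tangent_space A p"
    unfolding v_def by (rule tangent_space_lincomb) (rule Ep)
  have vE: "h p v (E j p) = a (E j p)" for j
  proof -
    have "h p v (E j p) = (\<Sum>i\<in>UNIV. z $ i * h p (E i p) (E j p))"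
      unfolding v_def by (rule tangent_linear_lincomb[OF tensor_linear(1)[OF tensor Ep]]) (rule Ep)
    also have "\<dots> = (H p *v z) $ j"
      by (simp add: H matrix_vector_mult_def mult.commute)
    finally show ?thesis using z by simp
  qed
  have "h p v w = a w" if w: "w \<in> tangent_space A p" for w
  proof -
    have "h p v w = h p v (\<lambda>f. \<Sum>i\<in>UNIV. w (x i) * E i p f)"
      using span[OF p w] by simp
    also have "\<dots> = (\<Sum>i\<in>UNIV. w (x i) * h p v (E i p))"
      by (rule tangent_linear_lincomb[OF tensor_linear(2)[OF tensor v]]) (rule Ep)
    also have "\<dots> = a (\<lambda>f. \<Sum>i\<in>UNIV. w (x i) * E i p f)"
      unfolding vE by (rule tangent_linear_lincomb[OF cotangent_linear[OF a], symmetric]) (rule Ep)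
    finally show ?thesis using span[OF p w] by simp
  qed
  then show ?thesis
    using v tensor_cancel by (intro ex1I[of _ v]) auto
qed

lemma sharp_tangent:
  assumes "\<alpha> \<in> one_forms A"
  shows "sharp A h \<alpha> p \<in> tangent_space A p"
    and "w \<in> tangent_space A p \<Longrightarrow> h p (sharp A h \<alpha> p) w = \<alpha> p w"
  using theI'[OF sharp_ex1[OF one_forms_cotangent[OF assms]]] by (simp_all add: sharp_def)

lemma sharp_vector_field:
  assumes \<alpha>: "\<alpha> \<in> one_forms A"
  shows "sharp A h \<alpha> \<in> vector_fields A"
proof -
  let ?Z = "sharp A h \<alpha>"
  have "(\<lambda>p. ?Z p f) \<in> smooth_functions A" if f: "f \<in> smooth_functions A" for f
  proof (rule smooth_functionsI)
    fix p
    obtain N E x and H :: "'a \<Rightarrow> real ^ 'n ^ 'n" where N: "open N" "p \<in> N"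
      and E: "\<And>i. E i \<in> vector_fields A"
      and span: "\<And>q v. q \<in> N \<Longrightarrow> v \<in> tangent_space A q \<Longrightarrow> v = (\<lambda>f. \<Sum>i\<in>UNIV. v (x i) * E i q f)"
      and H: "\<And>q. H q = (\<chi> j i. h q (E i q) (E j q))" and det: "\<And>q. q \<in> N \<Longrightarrow> det (H q) \<noteq> 0"
      by (rule gram_frame[of p]) blast
    have Eq: "E i q \<in> tangent_space A q" for i q using vector_fields_tangent[OF E] .
    \<comment> \<open>The numerator matrix of Cramer's rule: column \<open>k\<close> of the Gram
      matrix replaced by the right-hand side.\<close>
    define C where "C k q = (\<chi> i j. if j = k then \<alpha> q (E i q) else H q $ i $ j)" for k q
    have Hz: "H q *v (\<chi> i. ?Z q (x i)) = (\<chi> j. \<alpha> q (E j q))" if q: "q \<in> N" for q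
    proof -
      have "\<alpha> q (E j q) = (\<Sum>i\<in>UNIV. ?Z q (x i) * h q (E i q) (E j q))" for j
      proof -
        have "\<alpha> q (E j q) = h q (?Z q) (E j q)"
          using sharp_tangent(2)[OF \<alpha> Eq] by simp
        also have "\<dots> = h q (\<lambda>f. \<Sum>i\<in>UNIV. ?Z q (x i) * E i q f) (E j q)"
          using span[OF q sharp_tangent(1)[OF \<alpha>]] by simp
        also have "\<dots> = (\<Sum>i\<in>UNIV. ?Z q (x i) * h q (E i q) (E j q))"
          by (rule tangent_linear_lincomb[OF tensor_linear(1)[OF tensor Eq]]) (rule Eq)
        finally show ?thesis .
      qed
      then show ?thesis
        by (simp add: H matrix_vector_mult_def vec_eq_iff mult.commute)
    qed
    have coord: "?Z q (x k) = det (C k q) * inverse (det (H q))" if q: "q \<in> N" for q k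
      using arg_cong[OF iffD1[OF cramer[OF det[OF q]] Hz[OF q]], of "\<lambda>z. z $ k"]
      by (simp add: C_def divide_inverse cong: if_cong)
    have Hs: "smooth_fun_on A N (\<lambda>q. H q $ i $ j)" for i j
      unfolding H using smooth_functions_on[OF tensor_fields2_smooth[OF tensor E E]] by simp
    have Cs: "smooth_fun_on A N (\<lambda>q. C k q $ i $ j)" for i j k
      unfolding C_def using smooth_functions_on[OF one_forms_smooth[OF \<alpha> E]] Hs by (cases "j = k") simp_all
    note det_C = smooth_fun_on_det[OF N(1) Cs]
    note inv_det_H = smooth_fun_on_inverse[OF N(1) smooth_fun_on_det[OF N(1) Hs] det]
    note Ef = smooth_functions_on[OF vector_fields_smooth[OF E f]]
    have "smooth_fun_on A N (\<lambda>q. \<Sum>i\<in>UNIV. det (C i q) * inverse (det (H q)) * E i q f)"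
      by (rule smooth_fun_on_sum[OF N(1) smooth_fun_on_mult[OF N(1) smooth_fun_on_mult[OF N(1)
              det_C inv_det_H] Ef]])
    then have "smooth_fun_on A N (\<lambda>q. ?Z q f)"
    proof (rule smooth_fun_on_cong[OF N(1)])
      fix q assume q: "q \<in> N"
      show "(\<Sum>i\<in>UNIV. det (C i q) * inverse (det (H q)) * E i q f) = ?Z q f"
        using fun_cong[OF span[OF q sharp_tangent(1)[OF \<alpha>]], of f] coord[OF q] by simp
    qed
    then show "\<exists>M. open M \<and> p \<in> M \<and> smooth_fun_on A M (\<lambda>q. ?Z q f)"
      using N by blast
  qed
  then show ?thesis
    by (simp add: vector_fields_def sharp_tangent(1)[OF \<alpha>])
qed

lemma flat_one_form:
  assumes X: "X \<in> vector_fields A"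
  shows "flat A h X \<in> one_forms A"
proof -
  have "flat A h X p \<in> cotangent_space A p" for p
    using tensor_linear(2)[OF tensor vector_fields_tangent[OF X]]
    by (simp add: flat_def cotangent_space_def tangent_linear_def tangent_space_plus tangent_space_smult)
  then show ?thesis
    using tensor_fields2_smooth[OF tensor X]
    by (simp add: one_forms_def flat_def vector_fields_tangent)
qed

lemma sharp_flat:
  assumes X: "X \<in> vector_fields A"
  shows "sharp A h (flat A h X) = X"
proof
  fix p
  show "sharp A h (flat A h X) p = X p"
    by (rule tensor_cancel[where p = p])
      (simp_all add: sharp_tangent[OF flat_one_form[OF X]] vector_fields_tangent[OF X] flat_apply)
qed

lemma flat_sharp:
  assumes \<alpha>: "\<alpha> \<in> one_forms A"
  shows "flat A h (sharp A h \<alpha>) = \<alpha>"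
  by (rule one_form_eqI[OF flat_one_form[OF sharp_vector_field[OF \<alpha>]] \<alpha>])
    (simp add: flat_def vector_fields_tangent sharp_tangent(2)[OF \<alpha>])

end


section \<open>Dual connections\<close>

lemma dual_connection_eqI:
  assumes "\<exists>!\<mu>. is_dual_value A b G \<sigma> \<nu> \<mu>" "is_dual_value A b G \<sigma> \<nu> \<mu>"
    "\<sigma> \<in> gen_sections A" "\<nu> \<in> gen_sections A"
  shows "dual_connection A b G \<sigma> \<nu> = \<mu>"
  unfolding dual_connection_def using assms(3,4) the1_equality[OF assms(1,2)] by simp

text \<open>Two solutions pair equally with every section, since the right-hand side of the defining
  equation does not contain them. Cancellation is a premise so that both bilinear forms can use the
  argument.\<close>

lemma is_dual_value_ex1:
  assumes cancel: "\<And>\<mu> \<mu>'. \<mu> \<in> gen_sections A \<Longrightarrow> \<mu>' \<in> gen_sections A \<Longrightarrow>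
      (\<And>\<tau> p. \<tau> \<in> gen_sections A \<Longrightarrow> b \<tau> \<mu> p = b \<tau> \<mu>' p) \<Longrightarrow> \<mu> = \<mu>'"
    and \<mu>: "is_dual_value A b G \<sigma> \<nu> \<mu>"
  shows "\<exists>!\<mu>. is_dual_value A b G \<sigma> \<nu> \<mu>"
proof (rule ex1I[of _ \<mu>])
  fix \<mu>' assume \<mu>': "is_dual_value A b G \<sigma> \<nu> \<mu>'"
  have eq: "b \<tau> m p = fst \<sigma> p (b \<tau> \<nu>) - b (G \<sigma> \<tau>) \<nu> p"
    if "is_dual_value A b G \<sigma> \<nu> m" "\<tau> \<in> gen_sections A" for m \<tau> p
    using that unfolding is_dual_value_def by blast
  show "\<mu>' = \<mu>"
    using \<mu> \<mu>' by (intro cancel) (simp_all only: eq, simp_all only: is_dual_value_def)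
qed (rule \<mu>)

text \<open>The value 1 of \<open>s\<close> is the symmetric case, the value -1 the skew-symmetric
  one.\<close>

locale sign_symmetric_connection = nondegenerate_tensor A h
  for A :: "('a::{t2_space, second_countable_topology}, 'n::finite) atlas" and h +
  fixes s :: real and D :: "'a conn"
  assumes sign: "s * s = 1"
    and commute: "v \<in> tangent_space A p \<Longrightarrow> w \<in> tangent_space A p \<Longrightarrow> h p v w = s * h p w v"
    and connection: "affine_connection A D"
begin

lemma connection_vector_field:
  "X \<in> vector_fields A \<Longrightarrow> Y \<in> vector_fields A \<Longrightarrow> D X Y \<in> vector_fields A"
  using connection by (simp add: affine_connection_def)

text \<open>Cancellation in the second slot, obtained from \<open>tensor_cancel\<close> in the first
  by exchanging the arguments.\<close>

lemma vector_field_eqI: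
  assumes M: "M \<in> vector_fields A" "M' \<in> vector_fields A"
    and eq: "\<And>W p. W \<in> vector_fields A \<Longrightarrow> h p (W p) (M p) = h p (W p) (M' p)"
  shows "M = M'"
proof
  fix p
  show "M p = M' p"
  proof (rule tensor_cancel[where p = p])
    fix w assume w: "w \<in> tangent_space A p"
    then obtain W where W: "W \<in> vector_fields A" "W p = w" by (rule tangent_vector_extends)
    show "h p (M p) w = h p (M' p) w"
      using eq[OF W(1), of p] W(2) M w by (simp add: commute[of _ p w] vector_fields_tangent)
  qed (simp_all add: M vector_fields_tangent)
qed

lemma tensor_sharp_cov_flat:
  assumes X: "X \<in> vector_fields A" and Z: "Z \<in> vector_fields A" and W: "W \<in> vector_fields A"
  shows "h p (W p) (sharp A h (cov_form A D X (flat A h Z)) p) =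
    X p (\<lambda>q. h q (W q) (Z q)) - h p (D X W p) (Z p)"
proof -
  let ?C = "cov_form A D X (flat A h Z)"
  note C = cov_form[OF connection X flat_one_form[OF Z]]
  note tangent = vector_fields_tangent[OF W] vector_fields_tangent[OF Z]
    vector_fields_tangent[OF connection_vector_field[OF X W]]
  \<comment> \<open>\<open>sharp\<close> is characterised in the first slot of \<open>h\<close>;
    moving it there costs the first factor \<open>s\<close>.\<close>
  have "h p (W p) (sharp A h ?C p) = s * ?C p (W p)"
    by (simp only: commute[OF tangent(1) sharp_tangent(1)[OF C(1)]] sharp_tangent(2)[OF C(1) tangent(1)])
  also have "?C p (W p) = X p (\<lambda>q. flat A h Z q (W q)) - flat A h Z p (D X W p)"
    by (rule C(2)[OF W])
  \<comment> \<open>\<open>flat\<close> puts \<open>Z\<close> into the first slot; restoring the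
    order \<open>W\<close>, \<open>Z\<close> costs the second factor \<open>s\<close>, which cancels
    the first.\<close>
  also have "\<dots> = X p (\<lambda>q. s * h q (W q) (Z q)) - s * h p (D X W p) (Z p)"
    by (simp only: flat_apply tangent commute[OF tangent(2,1)] commute[OF tangent(2,3)])
  also have "X p (\<lambda>q. s * h q (W q) (Z q)) = s * X p (\<lambda>q. h q (W q) (Z q))"
    by (rule tangent_space_scale[OF vector_fields_tangent[OF X] tensor_fields2_smooth[OF tensor W Z]])
  also have "s * (s * X p (\<lambda>q. h q (W q) (Z q)) - s * h p (D X W p) (Z p)) =
      (s * s) * (X p (\<lambda>q. h q (W q) (Z q)) - h p (D X W p) (Z p))"
    by (simp add: algebra_simps)
  finally show ?thesis by (simp add: sign)
qed

lemma tensor_sharp_cov: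
  assumes X: "X \<in> vector_fields A" and \<gamma>: "\<gamma> \<in> one_forms A" and W: "W \<in> vector_fields A"
  shows "h p (W p) (sharp A h (cov_form A D X \<gamma>) p) =
    X p (\<lambda>q. h q (W q) (sharp A h \<gamma> q)) - h p (D X W p) (sharp A h \<gamma> p)"
  using tensor_sharp_cov_flat[OF X sharp_vector_field[OF \<gamma>] W] by (simp add: flat_sharp[OF \<gamma>])

text \<open>The closed formula of the theorem, shown below to solve the defining equations of both
  dual connections.\<close>

definition dual_value :: "'a gsec \<Rightarrow> 'a gsec \<Rightarrow> 'a gsec" where
  "dual_value \<sigma> \<nu> =
    (sharp A h (cov_form A D (fst \<sigma>) (flat A h (fst \<nu>))), cov_form A D (fst \<sigma>) (snd \<nu>))"

lemma dual_value_gen_section: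
  assumes "\<sigma> \<in> gen_sections A" "\<nu> \<in> gen_sections A"
  shows "dual_value \<sigma> \<nu> \<in> gen_sections A"
  using assms
  by (auto simp: dual_value_def intro!: sharp_vector_field cov_form(1)[OF connection] flat_one_form)

lemma is_dual_value_check:
  assumes \<sigma>: "\<sigma> \<in> gen_sections A" and \<nu>: "\<nu> \<in> gen_sections A"
  shows "is_dual_value A (check_h A h) (hat_nabla A h D) \<sigma> \<nu> (dual_value \<sigma> \<nu>)"
  unfolding is_dual_value_def
proof (intro conjI ballI allI)
  fix \<tau> p assume \<tau>: "\<tau> \<in> gen_sections A"
  obtain X \<alpha> where \<sigma>_eq: "\<sigma> = (X, \<alpha>)" by (cases \<sigma>)
  obtain Z \<gamma> where \<nu>_eq: "\<nu> = (Z, \<gamma>)" by (cases \<nu>)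
  obtain Y \<beta> where \<tau>_eq: "\<tau> = (Y, \<beta>)" by (cases \<tau>)
  have X: "X \<in> vector_fields A" and Z: "Z \<in> vector_fields A" and \<gamma>: "\<gamma> \<in> one_forms A"
    and Y: "Y \<in> vector_fields A" and \<beta>: "\<beta> \<in> one_forms A"
    using \<sigma> \<nu> \<tau> by (auto simp: \<sigma>_eq \<nu>_eq \<tau>_eq)
  note W = sharp_vector_field[OF \<beta>] and \<gamma>' = sharp_vector_field[OF \<gamma>]
  show "check_h A h \<tau> (dual_value \<sigma> \<nu>) p =
      fst \<sigma> p (check_h A h \<tau> \<nu>) - check_h A h (hat_nabla A h D \<sigma> \<tau>) \<nu> p"
    \<comment> \<open>The form part of \<open>hat_nabla\<close> is a \<open>flat\<close>, which the
      \<open>sharp\<close> inside \<open>check_h\<close> undoes. The two summands of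
      \<open>check_h\<close> then separate, with test fields \<open>Y\<close> and
      \<open>sharp A h \<beta>\<close>.\<close>
    using tensor_sharp_cov_flat[OF X Z Y, of p] tensor_sharp_cov[OF X \<gamma> W, of p]
      sharp_flat[OF connection_vector_field[OF X W]]
      tangent_space_add[OF vector_fields_tangent[OF X] tensor_fields2_smooth[OF tensor Y Z]
        tensor_fields2_smooth[OF tensor W \<gamma>']]
    by (simp add: \<sigma>_eq \<nu>_eq \<tau>_eq check_h_def hat_nabla_def dual_value_def)
qed (rule dual_value_gen_section[OF assms])

text \<open>The pairing crosses the components: the term with \<gamma> and \<open>Y\<close> is the
  definition of the covariant derivative of \<gamma>, and the term with \<beta> and \<open>Z\<close>
  is the sharp identity for \<open>W = sharp A h \<beta>\<close>, as \<beta> is \<open>flat\<close>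
  of that field.\<close>

lemma is_dual_value_hat:
  assumes \<sigma>: "\<sigma> \<in> gen_sections A" and \<nu>: "\<nu> \<in> gen_sections A"
    and hat: "\<And>X \<alpha> Y \<beta> p. hat_h A h (X, \<alpha>) (Y, \<beta>) p = - (1/2) * (\<alpha> p (Y p) + s * \<beta> p (X p))"
  shows "is_dual_value A (hat_h A h) (hat_nabla A h D) \<sigma> \<nu> (dual_value \<sigma> \<nu>)"
  unfolding is_dual_value_def
proof (intro conjI ballI allI)
  fix \<tau> p assume \<tau>: "\<tau> \<in> gen_sections A"
  obtain X \<alpha> where \<sigma>_eq: "\<sigma> = (X, \<alpha>)" by (cases \<sigma>)
  obtain Z \<gamma> where \<nu>_eq: "\<nu> = (Z, \<gamma>)" by (cases \<nu>)
  obtain Y \<beta> where \<tau>_eq: "\<tau> = (Y, \<beta>)" by (cases \<tau>)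
  have X: "X \<in> vector_fields A" and Z: "Z \<in> vector_fields A" and \<gamma>: "\<gamma> \<in> one_forms A"
    and Y: "Y \<in> vector_fields A" and \<beta>: "\<beta> \<in> one_forms A"
    using \<sigma> \<nu> \<tau> by (auto simp: \<sigma>_eq \<nu>_eq \<tau>_eq)
  let ?W = "sharp A h \<beta>" and ?M = "sharp A h (cov_form A D X (flat A h Z))"
  note W = sharp_vector_field[OF \<beta>]
  note Xp = vector_fields_tangent[OF X, of p]
  have M: "?M \<in> vector_fields A"
    by (intro sharp_vector_field cov_form(1)[OF connection X] flat_one_form Z)
  have \<beta>M: "\<beta> p (?M p) = X p (\<lambda>q. \<beta> q (Z q)) - flat A h (D X ?W) p (Z p)"
    using tensor_sharp_cov_flat[OF X Z W, of p] vector_fields_tangent[OF M, of p]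
      vector_fields_tangent[OF Z] by (simp add: sharp_tangent(2)[OF \<beta>] flat_apply)
  have "X p (hat_h A h \<tau> \<nu>) = X p (\<lambda>q. - (1/2) * (\<beta> q (Z q) + s * \<gamma> q (Y q)))"
    by (rule arg_cong[of _ _ "X p"]) (simp add: \<tau>_eq \<nu>_eq hat fun_eq_iff)
  also have "\<dots> = - (1/2) * (X p (\<lambda>q. \<beta> q (Z q)) + s * X p (\<lambda>q. \<gamma> q (Y q)))"
    by (simp only: tangent_space_scale[OF Xp] tangent_space_add[OF Xp] one_forms_smooth[OF \<beta> Z]
        one_forms_smooth[OF \<gamma> Y] smooth_functions_add smooth_functions_mult smooth_functions_const)
  finally have X_hat: "X p (hat_h A h \<tau> \<nu>) = \<dots>" .
  have "hat_h A h \<tau> (dual_value \<sigma> \<nu>) p = - (1/2) * (\<beta> p (?M p) + s * cov_form A D X \<gamma> p (Y p))"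
    by (simp add: \<sigma>_eq \<nu>_eq \<tau>_eq hat dual_value_def)
  moreover have "hat_h A h (hat_nabla A h D \<sigma> \<tau>) \<nu> p =
      - (1/2) * (flat A h (D X ?W) p (Z p) + s * \<gamma> p (D X Y p))"
    by (simp add: \<sigma>_eq \<nu>_eq \<tau>_eq hat hat_nabla_def)
  ultimately show "hat_h A h \<tau> (dual_value \<sigma> \<nu>) p =
      fst \<sigma> p (hat_h A h \<tau> \<nu>) - hat_h A h (hat_nabla A h D \<sigma> \<tau>) \<nu> p"
    unfolding \<beta>M cov_form(2)[OF connection X \<gamma> Y] \<sigma>_eq fst_conv X_hat by (simp add: algebra_simps)
qed (rule dual_value_gen_section[OF assms(1,2)])

lemma zero_one_form: "(\<lambda>p v. 0) \<in> one_forms A"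
  by (simp add: one_forms_def cotangent_space_def smooth_functions_const)

text \<open>Test sections with one zero component isolate the two summands. A second component
  \<open>flat A h W\<close> makes the test field \<open>W\<close> reappear under
  \<open>sharp\<close>.\<close>

lemma check_h_cancel:
  assumes \<mu>: "\<mu> \<in> gen_sections A" "\<mu>' \<in> gen_sections A"
    and eq: "\<And>\<tau> p. \<tau> \<in> gen_sections A \<Longrightarrow> check_h A h \<tau> \<mu> p = check_h A h \<tau> \<mu>' p"
  shows "\<mu> = \<mu>'"
proof -
  obtain M \<theta> where \<mu>_eq: "\<mu> = (M, \<theta>)" by (cases \<mu>)
  obtain M' \<theta>' where \<mu>'_eq: "\<mu>' = (M', \<theta>')" by (cases \<mu>')
  have M: "M \<in> vector_fields A" "M' \<in> vector_fields A" and \<theta>: "\<theta> \<in> one_forms A" "\<theta>' \<in> one_forms A"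
    using \<mu> by (auto simp: \<mu>_eq \<mu>'_eq)
  note \<theta>_sharp = sharp_vector_field[OF \<theta>(1)] sharp_vector_field[OF \<theta>(2)]
  \<comment> \<open>\<open>sharp\<close> is a description, so its value at the zero form is found by
    writing that form as a \<open>flat\<close>.\<close>
  have "flat A h (\<lambda>p f. 0) = (\<lambda>p v. 0)"
    using tangent_linear_zero[OF tensor_linear(1)[OF tensor]] by (auto simp: flat_def fun_eq_iff)
  then have sharp_0: "sharp A h (\<lambda>p v. 0) = (\<lambda>p f. 0)"
    using sharp_flat[OF vector_fields_zero] by simp
  have h_0: "h p (\<lambda>f. 0) w = 0" if "w \<in> tangent_space A p" for p w
    using tangent_linear_zero[OF tensor_linear(1)[OF tensor that]] .
  have "M = M'"
  proof (rule vector_field_eqI[OF M])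
    fix W p assume "W \<in> vector_fields A"
    then show "h p (W p) (M p) = h p (W p) (M' p)"
      using eq[of "(W, \<lambda>p v. 0)" p] zero_one_form \<theta>_sharp
      by (simp add: check_h_def \<mu>_eq \<mu>'_eq sharp_0 h_0 vector_fields_tangent)
  qed
  moreover have "sharp A h \<theta> = sharp A h \<theta>'"
  proof (rule vector_field_eqI[OF \<theta>_sharp])
    fix W p assume W: "W \<in> vector_fields A"
    then show "h p (W p) (sharp A h \<theta> p) = h p (W p) (sharp A h \<theta>' p)"
      using eq[of "(\<lambda>p f. 0, flat A h W)" p] vector_fields_zero flat_one_form[OF W] M
      by (simp add: check_h_def \<mu>_eq \<mu>'_eq sharp_flat h_0 vector_fields_tangent)
  qed
  then have "\<theta> = \<theta>'" by (metis flat_sharp \<theta>)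
  ultimately show ?thesis by (simp add: \<mu>_eq \<mu>'_eq)
qed

text \<open>Here the test sections see the opposite components: a pure field detects the form, up to
  the nonzero factor \<open>s\<close>, and a pure form \<open>flat A h W\<close> detects the
  field.\<close>

lemma hat_h_cancel:
  assumes \<mu>: "\<mu> \<in> gen_sections A" "\<mu>' \<in> gen_sections A"
    and hat: "\<And>X \<alpha> Y \<beta> p. hat_h A h (X, \<alpha>) (Y, \<beta>) p = - (1/2) * (\<alpha> p (Y p) + s * \<beta> p (X p))"
    and eq: "\<And>\<tau> p. \<tau> \<in> gen_sections A \<Longrightarrow> hat_h A h \<tau> \<mu> p = hat_h A h \<tau> \<mu>' p"
  shows "\<mu> = \<mu>'"
proof -
  obtain M \<theta> where \<mu>_eq: "\<mu> = (M, \<theta>)" by (cases \<mu>)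
  obtain M' \<theta>' where \<mu>'_eq: "\<mu>' = (M', \<theta>')" by (cases \<mu>')
  have M: "M \<in> vector_fields A" "M' \<in> vector_fields A" and \<theta>: "\<theta> \<in> one_forms A" "\<theta>' \<in> one_forms A"
    using \<mu> by (auto simp: \<mu>_eq \<mu>'_eq)
  have "s \<noteq> 0" using sign by auto
  have "\<theta> = \<theta>'"
  proof (rule one_form_eqI[OF \<theta>])
    fix Y p assume "Y \<in> vector_fields A"
    then show "\<theta> p (Y p) = \<theta>' p (Y p)"
      using eq[of "(Y, \<lambda>p v. 0)" p] zero_one_form \<open>s \<noteq> 0\<close> by (simp add: hat \<mu>_eq \<mu>'_eq)
  qed
  moreover have "M = M'"
  proof (rule vector_field_eqI[OF M])
    fix W p assume W: "W \<in> vector_fields A"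
    then show "h p (W p) (M p) = h p (W p) (M' p)"
      using eq[of "(\<lambda>p f. 0, flat A h W)" p] vector_fields_zero flat_one_form[OF W] M
        tangent_linear_zero[OF one_forms_linear[OF \<theta>(1)]]
        tangent_linear_zero[OF one_forms_linear[OF \<theta>(2)]]
      by (simp add: hat \<mu>_eq \<mu>'_eq flat_apply vector_fields_tangent)
  qed
  ultimately show ?thesis by (simp add: \<mu>_eq \<mu>'_eq)
qed

end

theorem proposition3p7:
  fixes A :: "('a::{t2_space, second_countable_topology}, 'n::finite) atlas"
    and h :: "'a tensor2"
    and nabla :: "'a conn"
  assumes "quasi_statistical_manifold A h nabla"
    and "symmetric_tensor A h \<or> skew_tensor A h"
  shows "(\<forall>\<sigma> \<in> gen_sections A. \<forall>\<nu> \<in> gen_sections A.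
            (\<exists>!\<mu>. is_dual_value A (check_h A h) (hat_nabla A h nabla) \<sigma> \<nu> \<mu>) \<and>
            (\<exists>!\<mu>. is_dual_value A (hat_h A h) (hat_nabla A h nabla) \<sigma> \<nu> \<mu>)) \<and>
         (\<forall>X \<in> vector_fields A. \<forall>Z \<in> vector_fields A. \<forall>\<alpha> \<in> one_forms A. \<forall>\<gamma> \<in> one_forms A.
            dual_connection A (check_h A h) (hat_nabla A h nabla) (X, \<alpha>) (Z, \<gamma>) =
              (sharp A h (cov_form A nabla X (flat A h Z)), cov_form A nabla X \<gamma>)) \<and>
         dual_connection A (check_h A h) (hat_nabla A h nabla) =
           dual_connection A (hat_h A h) (hat_nabla A h nabla)"
proof -
  \<comment> \<open>Symmetry is tested exactly as in \<open>hat_h\<close>, so the formula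
    \<open>hat\<close> holds in both branches.\<close>
  define s :: real where "s = (if symmetric_tensor A h then 1 else - 1)"
  interpret sign_symmetric_connection A h s nabla
  proof
    fix v w p assume "v \<in> tangent_space A p" "w \<in> tangent_space A p"
    then show "h p v w = s * h p w v"
      using assms(2) by (auto simp: s_def symmetric_tensor_def skew_tensor_def)
  qed (use assms(1) in \<open>simp_all add: quasi_statistical_manifold_def s_def\<close>)
  have hat: "hat_h A h (X, \<alpha>) (Y, \<beta>) p = - (1/2) * (\<alpha> p (Y p) + s * \<beta> p (X p))" for X \<alpha> Y \<beta> p
    by (simp add: hat_h_def s_def)
  let ?G = "hat_nabla A h nabla"
  have check_ex1: "\<exists>!\<mu>. is_dual_value A (check_h A h) ?G \<sigma> \<nu> \<mu>"
    if "\<sigma> \<in> gen_sections A" "\<nu> \<in> gen_sections A" for \<sigma> \<nu>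
    by (rule is_dual_value_ex1[OF check_h_cancel is_dual_value_check[OF that]])
  have hat_ex1: "\<exists>!\<mu>. is_dual_value A (hat_h A h) ?G \<sigma> \<nu> \<mu>"
    if "\<sigma> \<in> gen_sections A" "\<nu> \<in> gen_sections A" for \<sigma> \<nu>
    by (rule is_dual_value_ex1[OF hat_h_cancel[OF _ _ hat] is_dual_value_hat[OF that hat]])
  have check_eq: "dual_connection A (check_h A h) ?G \<sigma> \<nu> = dual_value \<sigma> \<nu>"
    if "\<sigma> \<in> gen_sections A" "\<nu> \<in> gen_sections A" for \<sigma> \<nu>
    by (rule dual_connection_eqI[OF check_ex1[OF that] is_dual_value_check[OF that] that])
  have hat_eq: "dual_connection A (hat_h A h) ?G \<sigma> \<nu> = dual_value \<sigma> \<nu>"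
    if "\<sigma> \<in> gen_sections A" "\<nu> \<in> gen_sections A" for \<sigma> \<nu>
    by (rule dual_connection_eqI[OF hat_ex1[OF that] is_dual_value_hat[OF that hat] that])
  have "dual_connection A (check_h A h) ?G \<sigma> \<nu> = dual_connection A (hat_h A h) ?G \<sigma> \<nu>" for \<sigma> \<nu>
  proof (cases "\<sigma> \<in> gen_sections A \<and> \<nu> \<in> gen_sections A")
    case True
    then show ?thesis using check_eq hat_eq by simp
  next
    \<comment> \<open>Off the sections both dual connections take the value
      \<open>undefined\<close>, so they agree as functions on all arguments.\<close>
    case False
    then show ?thesis unfolding dual_connection_def by (simp only: if_False)
  qed
  then show ?thesis
    using check_ex1 hat_ex1 check_eq by (auto simp: dual_value_def fun_eq_iff)
qed

end
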